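(* Let $H$ be an infinite dimensional Hilbert space. Then: (1) for every $T\in\mathcal{B}(H)$, $$d(T,B_{\mathcal{K}(H)})=\max\{\|T\|-1,\Delta(T)\}=\max\{\|T\|-1,d(T,\mathcal{K}(H))\};$$ (2) $\mathcal{K}(H)$ is ball proximinal in $\mathcal{B}(H)$.
   Context: $\mathcal{B}(H)$ is the space of bounded linear operators on $H$ with the operator norm, and $\mathcal{K}(H)$ is the subspace of compact operators. For a Banach space $Y$, $B_Y$ denotes its closed unit ball. For a non-empty closed subset $K$ of a Banach space $X$ and $x\in X$, $d(x,K)=\inf_{k\in K}\|x-k\|$; $K$ is proximinal in $X$ if for every $x\in X$ there is $k\in K$ with $\|x-k\|=d(x,K)$. A closed subspace $Y$ of $X$ is ball proximinal in $X$ if $B_Y$ is proximinal in $X$. Let $S(H)$ be the set of all sequences of unit vectors in $H$ that converge weakly to $0$. For $T\in\mathcal{B}(H)$, $\Delta(T)=\sup\{\limsup_{n\to\infty}\|Ts_n\| : (s_n)\in S(H)\}$. *)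

theory Defs
  imports "HOL-Analysis.Analysis"
begin

text \<open>
  Real Hilbert spaces are the types of sort \<open>{real_inner, complete_space}\<close>.  Complex ones are
  the types of sort \<open>{complex_inner, complete_space}\<close>, where the class below adds to the
  underlying real inner product space (with inner product \<open>Re \<langle>x, y\<rangle>\<close> and hence the same norm)
  the complex scalar multiplication and the complex inner product, linear in the first argument.
\<close>

class complex_inner = real_inner +
  fixes scaleC :: "complex \<Rightarrow> 'a \<Rightarrow> 'a" (infixr "*\<^sub>C" 75)
    and cinner :: "'a \<Rightarrow> 'a \<Rightarrow> complex"
  assumes scaleC_add_right: "a *\<^sub>C (x + y) = a *\<^sub>C x + a *\<^sub>C y"
    and scaleC_add_left: "(a + b) *\<^sub>C x = a *\<^sub>C x + b *\<^sub>C x"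
    and scaleC_scaleC: "a *\<^sub>C (b *\<^sub>C x) = (a * b) *\<^sub>C x"
    and scaleC_one: "1 *\<^sub>C x = x"
    and scaleR_scaleC: "r *\<^sub>R x = complex_of_real r *\<^sub>C x"
    and cinner_commute: "cinner x y = cnj (cinner y x)"
    and cinner_add_left: "cinner (x + y) z = cinner x z + cinner y z"
    and cinner_scaleC_left: "cinner (a *\<^sub>C x) y = a * cinner x y"
    and inner_eq_Re_cinner: "inner x y = Re (cinner x y)"

text \<open>
  The remaining notions are parametrised by the scalar multiplication, so that instantiating it
  with \<^term>\<open>scaleR\<close> or \<^term>\<open>scaleC\<close> gives the real and the complex case.
\<close>

definition infinite_dimensional :: "('k::field \<Rightarrow> 'a::ab_group_add \<Rightarrow> 'a) \<Rightarrow> bool" where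
  "infinite_dimensional scl \<longleftrightarrow> (\<nexists>B. finite_dimensional_vector_space scl B)"

text \<open>
  \<open>'a \<Rightarrow>\<^sub>L 'a\<close> consists of the real-linear bounded operators with the operator norm, so for
  complex scalars one has to single out the operators that are linear over the scalar field.
  For \<^term>\<open>scaleR\<close> the condition holds for every element of the type.
\<close>

definition bounded_ops ::
  "('k::real_normed_field \<Rightarrow> 'a::real_normed_vector \<Rightarrow> 'a) \<Rightarrow> ('a \<Rightarrow>\<^sub>L 'a) set" where
  "bounded_ops scl = {T. Vector_Spaces.linear scl scl (blinfun_apply T)}"

definition compact_ops ::
  "('k::real_normed_field \<Rightarrow> 'a::real_normed_vector \<Rightarrow> 'a) \<Rightarrow> ('a \<Rightarrow>\<^sub>L 'a) set" where
  "compact_ops scl =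
     {T \<in> bounded_ops scl. compact (closure (blinfun_apply T ` cball 0 1))}"

definition weakly_tendsto ::
  "('k::real_normed_field \<Rightarrow> 'a::real_normed_vector \<Rightarrow> 'a) \<Rightarrow> (nat \<Rightarrow> 'a) \<Rightarrow> 'a \<Rightarrow> bool" where
  "weakly_tendsto scl s l \<longleftrightarrow>
     (\<forall>f :: 'a \<Rightarrow>\<^sub>L 'k. Vector_Spaces.linear scl (*) (blinfun_apply f) \<longrightarrow>
        (\<lambda>n. blinfun_apply f (s n)) \<longlonglongrightarrow> blinfun_apply f l)"

definition weakly_null_unit_seqs ::
  "('k::real_normed_field \<Rightarrow> 'a::real_normed_vector \<Rightarrow> 'a) \<Rightarrow> (nat \<Rightarrow> 'a) set" where
  "weakly_null_unit_seqs scl = {s. (\<forall>n. norm (s n) = 1) \<and> weakly_tendsto scl s 0}"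

text \<open>
  \<open>\<Delta>(T)\<close> is taken in the extended reals, where suprema and limsups exist.
\<close>

definition Delta ::
  "('k::real_normed_field \<Rightarrow> 'a::real_normed_vector \<Rightarrow> 'a) \<Rightarrow> ('a \<Rightarrow>\<^sub>L 'a) \<Rightarrow> ereal" where
  "Delta scl T =
     (SUP s \<in> weakly_null_unit_seqs scl. limsup (\<lambda>n. ereal (norm (blinfun_apply T (s n)))))"

text \<open>
  The ambient space \<open>X\<close> is a subset of a normed space since the complex-linear operators form a
  proper subset of their type.  Proximinality involves only the norm, so for complex spaces
  the underlying real vector space structure is used in \<open>ball_proximinal_in\<close>.
\<close>

definition proximinal_in :: "'v::real_normed_vector set \<Rightarrow> 'v set \<Rightarrow> bool" where
  "proximinal_in K X \<longleftrightarrow>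
     K \<noteq> {} \<and> closed K \<and> K \<subseteq> X \<and> (\<forall>x\<in>X. \<exists>k\<in>K. norm (x - k) = infdist x K)"

definition ball_proximinal_in :: "'v::real_normed_vector set \<Rightarrow> 'v set \<Rightarrow> bool" where
  "ball_proximinal_in Y X \<longleftrightarrow>
     subspace Y \<and> closed Y \<and> Y \<subseteq> X \<and> proximinal_in (Y \<inter> cball 0 1) X"

end

theory Submission
  imports Defs
begin

text \<open>
  Both distances are bounded below by \<open>\<Delta>(T)\<close>, since a compact \<open>K\<close> maps weakly null sequences to
  norm null ones, and the distance to the unit ball is at least \<open>\<parallel>T\<parallel> - 1\<close>.  Conversely, let
  \<open>r = max (\<parallel>T\<parallel> - 1) (\<Delta>(T))\<close>.  On the orthogonal complement of finitely many eigenvectors of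
  \<open>T\<^sup>*T\<close>, the operator \<open>T\<close> attains its norm as long as that norm exceeds \<open>r \<ge> \<Delta>(T)\<close>, and a maximiser
  is again an eigenvector.  A maximal orthonormal set \<open>E\<close> of eigenvectors \<open>e\<close> with \<open>\<parallel>T e\<parallel> > r\<close> has
  only finitely many members with \<open>\<parallel>T e\<parallel> \<ge> r + \<epsilon>\<close>, because orthonormal sequences are weakly null.
  Hence \<open>K x = (\<Sum>e\<in>E. (1 - r / \<parallel>T e\<parallel>) \<langle>e, x\<rangle> T e)\<close> is compact, with \<open>\<parallel>K\<parallel> \<le> \<parallel>T\<parallel> - r \<le> 1\<close> (or \<open>K = 0\<close>)
  and \<open>\<parallel>T - K\<parallel> \<le> r\<close>.
\<close>

subsection \<open>Projections and the Riesz representation theorem\<close>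

text \<open>A minimising sequence for the distance from \<open>x\<close> to \<open>M\<close> is
  Cauchy by the parallelogram law. Its limit \<open>p\<close> is a nearest point, and minimality
  along each line in \<open>M\<close> through \<open>p\<close> forces orthogonality.\<close>

lemma closed_subspace_projection:
  fixes M :: "'a::{real_inner, complete_space} set"
  assumes "closed M" "subspace M"
  obtains p where "p \<in> M" "\<And>m. m \<in> M \<Longrightarrow> inner (x - p) m = 0"
proof -
  define d where "d = (INF m\<in>M. (norm (x - m))\<^sup>2)"
  have d_le: "d \<le> (norm (x - m))\<^sup>2" if "m \<in> M" for m
    unfolding d_def by (rule cINF_lower) (auto intro!: bdd_belowI2[where m=0] that)
  have "\<exists>m\<in>M. (norm (x - m))\<^sup>2 < d + 1 / real (Suc n)" for n
  proof -
    have "(INF m\<in>M. (norm (x - m))\<^sup>2) < d + 1 / real (Suc n)"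
      by (simp add: d_def)
    moreover have "(\<lambda>m. (norm (x - m))\<^sup>2) ` M \<noteq> {}"
      using subspace_0[OF assms(2)] by blast
    ultimately show ?thesis
      using cInf_lessD[of "(\<lambda>m. (norm (x - m))\<^sup>2) ` M"] by fast
  qed
  then obtain m where m: "\<And>n. m n \<in> M" "\<And>n. (norm (x - m n))\<^sup>2 < d + 1 / real (Suc n)"
    by metis
  have dist_m: "(norm (m j - m k))\<^sup>2 \<le> 2 * (1 / real (Suc j)) + 2 * (1 / real (Suc k))" for j k
  proof -
    have "(1/2) *\<^sub>R (m j + m k) \<in> M"
      using assms(2) m(1) by (simp add: subspace_add subspace_scale)
    then have "d \<le> (norm (x - (1/2) *\<^sub>R (m j + m k)))\<^sup>2"
      by (rule d_le)
    \<comment> \<open>Parallelogram law: the midpoint lies in \<open>M\<close>, so two nearly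
      optimal points are close together.\<close>
    moreover have "(norm (m j - m k))\<^sup>2
      = 2 * (norm (x - m j))\<^sup>2 + 2 * (norm (x - m k))\<^sup>2 - 4 * (norm (x - (1/2) *\<^sub>R (m j + m k)))\<^sup>2"
      by (simp add: power2_norm_eq_inner algebra_simps inner_commute)
    ultimately show ?thesis
      using m(2)[of j] m(2)[of k] by linarith
  qed
  have "Cauchy m"
  proof (rule metric_CauchyI)
    fix e :: real
    assume "0 < e"
    obtain N where N: "4 / e\<^sup>2 < real N"
      using reals_Archimedean2 by blast
    have "dist (m j) (m k) < e" if "N \<le> j" "N \<le> k" for j k
    proof -
      have "0 < real N"
        using N \<open>0 < e\<close> by (smt (verit) divide_pos_pos zero_less_power)
      have "(norm (m j - m k))\<^sup>2 \<le> 2 * (1 / real (Suc j)) + 2 * (1 / real (Suc k))"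
        by (rule dist_m)
      also have "\<dots> \<le> 2 * (1 / real N) + 2 * (1 / real N)"
        using that \<open>0 < real N\<close> by (intro add_mono mult_left_mono divide_left_mono) auto
      also have "\<dots> < e\<^sup>2"
        using N \<open>0 < e\<close> \<open>0 < real N\<close> by (simp add: field_simps)
      finally show ?thesis
        using \<open>0 < e\<close> by (simp add: dist_norm power2_less_imp_less)
    qed
    then show "\<exists>N. \<forall>j\<ge>N. \<forall>k\<ge>N. dist (m j) (m k) < e"
      by blast
  qed
  then obtain p where p: "m \<longlonglongrightarrow> p"
    using Cauchy_convergent convergent_def by blast
  have "p \<in> M"
    using assms(1) m(1) p closed_sequentially by blast
  have "(\<lambda>n. (norm (x - m n))\<^sup>2) \<longlonglongrightarrow> (norm (x - p))\<^sup>2"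
    by (intro tendsto_intros p)
  moreover have "(\<lambda>n. d + 1 / real (Suc n)) \<longlonglongrightarrow> d"
    using tendsto_add[OF tendsto_const LIMSEQ_Suc[OF lim_1_over_n]] by simp
  ultimately have p_le: "(norm (x - p))\<^sup>2 \<le> d"
    using m(2) by (force intro: LIMSEQ_le less_imp_le)
  have "inner (x - p) v = 0" if "v \<in> M" for v
  proof (rule ccontr)
    assume nz: "inner (x - p) v \<noteq> 0"
    then have "inner v v \<noteq> 0"
      by auto
    \<comment> \<open>This \<open>t\<close> minimises the quadratic
      \<open>norm (x - p - t v)\<close> squared, so a nonzero inner product would give a point of
      \<open>M\<close> nearer than \<open>p\<close>.\<close>
    define t where "t = inner (x - p) v / inner v v"
    have "p + t *\<^sub>R v \<in> M"
      using assms(2) \<open>p \<in> M\<close> that by (simp add: subspace_add subspace_scale)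
    then have "(norm (x - p))\<^sup>2 \<le> (norm ((x - p) - t *\<^sub>R v))\<^sup>2"
      using order_trans[OF p_le d_le] by (simp add: diff_diff_eq)
    also have "\<dots> = (norm (x - p))\<^sup>2 - 2 * t * inner (x - p) v + t * (t * inner v v)"
      unfolding power2_norm_eq_inner
      by (simp add: inner_diff_left inner_diff_right inner_commute algebra_simps)
    also have "t * inner v v = inner (x - p) v"
      using \<open>inner v v \<noteq> 0\<close> by (simp add: t_def)
    finally have "t * inner (x - p) v \<le> 0"
      by simp
    moreover have "0 < t * inner (x - p) v"
      using nz by (simp add: t_def zero_less_divide_iff mult_neg_neg)
        (metis inner_zero_right not_real_square_gt_zero)
    ultimately show False
      by simp
  qed
  with \<open>p \<in> M\<close> show ?thesis
    using that by blast
qed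

text \<open>The kernel of a nonzero functional is a closed hyperplane. A normal vector
  \<open>u\<close> determines the functional up to a factor, which its value at \<open>u\<close>
  fixes.\<close>

lemma Riesz_representation:
  fixes f :: "'a::{real_inner, complete_space} \<Rightarrow> real"
  assumes "bounded_linear f"
  obtains a where "\<And>x. f x = inner a x"
proof (cases "\<forall>x. f x = 0")
  case True
  then show ?thesis
    using that[of 0] by simp
next
  case False
  then obtain x where x: "f x \<noteq> 0"
    by blast
  interpret f: bounded_linear f
    by fact
  define M where "M = f -` {0}"
  have "closed M"
    unfolding M_def by (intro closed_vimage f.continuous_on continuous_on_id) auto
  moreover have "subspace M"
    by (auto simp: M_def subspace_def f.add f.scaleR f.zero)
  ultimately obtain p where p: "p \<in> M" "\<And>m. m \<in> M \<Longrightarrow> inner (x - p) m = 0"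
    using closed_subspace_projection by blast
  define u where "u = x - p"
  have fu: "f u = f x"
    using p(1) by (simp add: u_def f.diff M_def)
  then have "u \<noteq> 0"
    using x f.zero by metis
  show ?thesis
  proof (rule that[of "(f u / inner u u) *\<^sub>R u"])
    fix y
    have "y - (f y / f u) *\<^sub>R u \<in> M"
      using x fu by (simp add: M_def f.diff f.scaleR)
    then have "inner u y = (f y / f u) * inner u u"
      using p(2)[of "y - (f y / f u) *\<^sub>R u"] by (simp add: u_def[symmetric] inner_diff_right)
    then show "f y = inner ((f u / inner u u) *\<^sub>R u) y"
      using x fu \<open>u \<noteq> 0\<close> by simp
  qed
qed

text \<open>By Riesz, weak convergence may be tested with inner products alone.\<close>

lemma weakly_tendsto_real_zero_iff:
  fixes s :: "nat \<Rightarrow> 'a::{real_inner, complete_space}"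
  shows "weakly_tendsto scaleR s 0 \<longleftrightarrow> (\<forall>a. (\<lambda>n. inner a (s n)) \<longlonglongrightarrow> 0)"
proof
  assume w: "weakly_tendsto scaleR s 0"
  show "\<forall>a. (\<lambda>n. inner a (s n)) \<longlonglongrightarrow> 0"
  proof
    fix a :: 'a
    have bl: "bounded_linear (\<lambda>x. inner a x)"
      by (rule bounded_linear_inner_right)
    have "Vector_Spaces.linear scaleR (*) (blinfun_apply (Blinfun (\<lambda>x. inner a x)))"
      using bounded_linear.linear[OF bl]
      by (simp add: bounded_linear_Blinfun_apply[OF bl] linear_def real_scaleR_def[abs_def])
    then show "(\<lambda>n. inner a (s n)) \<longlonglongrightarrow> 0"
      using w[unfolded weakly_tendsto_def, rule_format, of "Blinfun (\<lambda>x. inner a x)"]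
      by (simp add: bounded_linear_Blinfun_apply[OF bl])
  qed
next
  assume w: "\<forall>a. (\<lambda>n. inner a (s n)) \<longlonglongrightarrow> 0"
  show "weakly_tendsto scaleR s 0"
    unfolding weakly_tendsto_def
  proof (intro allI impI)
    fix f :: "'a \<Rightarrow>\<^sub>L real"
    obtain a where "\<And>x. f x = inner a x"
      using Riesz_representation blinfun.bounded_linear_right by blast
    then show "(\<lambda>n. f (s n)) \<longlonglongrightarrow> f 0"
      using w by simp
  qed
qed

subsection \<open>Attainment of the norm\<close>

text \<open>This encodes \<open>Delta scaleR T \<le> ereal r\<close> by real inequalities, as
  \<open>Delta_le_iff\<close> shows; a limsup is at most \<open>r\<close> when the terms are
  eventually below each \<rho> above \<open>r\<close>.\<close>

definition weakly_null_bound :: "('a::{real_inner, complete_space} \<Rightarrow>\<^sub>L 'a) \<Rightarrow> real \<Rightarrow> bool" where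
  "weakly_null_bound T r \<longleftrightarrow>
     (\<forall>s \<in> weakly_null_unit_seqs scaleR. \<forall>\<rho>>r. \<forall>\<^sub>F n in sequentially. norm (T (s n)) < \<rho>)"

lemma weakly_null_boundD:
  "weakly_null_bound T r \<Longrightarrow> s \<in> weakly_null_unit_seqs scaleR \<Longrightarrow> r < \<rho> \<Longrightarrow>
     \<forall>\<^sub>F n in sequentially. norm (T (s n)) < \<rho>"
  unfolding weakly_null_bound_def by blast

lemma weakly_null_unit_seqs_real_iff:
  "s \<in> weakly_null_unit_seqs (scaleR :: real \<Rightarrow> 'a::{real_inner, complete_space} \<Rightarrow> 'a) \<longleftrightarrow>
     (\<forall>n. norm (s n) = 1) \<and> (\<forall>a. (\<lambda>n. inner a (s n)) \<longlonglongrightarrow> 0)"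
  by (simp add: weakly_null_unit_seqs_def weakly_tendsto_real_zero_iff)

text \<open>If all unit vectors stayed below \<open>norm S - 1 / real (Suc n)\<close>, homogeneity
  would make this number an operator bound smaller than the norm.\<close>

lemma blinfun_norm_maximizing_sequence:
  fixes S :: "'a::real_normed_vector \<Rightarrow>\<^sub>L 'b::real_normed_vector"
  assumes "0 < norm S"
  obtains x where "\<And>n. norm (x n) = 1" "(\<lambda>n. norm (S (x n))) \<longlonglongrightarrow> norm S"
proof -
  have "\<exists>x. norm x = 1 \<and> norm S - 1 / real (Suc n) < norm (S x)" for n
  proof (rule ccontr)
    assume "\<not> ?thesis"
    then have *: "norm (S x) \<le> norm S - 1 / real (Suc n)" if "norm x = 1" for x
      using that by (meson not_le)
    obtain z where "S z \<noteq> 0"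
      using assms by (metis blinfun_eqI norm_zero less_irrefl zero_blinfun.rep_eq)
    then have "z \<noteq> 0"
      by auto
    \<comment> \<open>\<open>norm_blinfun_bound\<close> asks for a nonnegative bound; any unit
      vector provides it, and one exists because \<open>S\<close> is nonzero.\<close>
    then have "0 \<le> norm S - 1 / real (Suc n)"
      by (intro order_trans[OF norm_ge_zero *[of "sgn z"]]) (simp add: norm_sgn)
    moreover have "norm (S x) \<le> (norm S - 1 / real (Suc n)) * norm x" for x
    proof (cases "x = 0")
      case False
      have "S x = norm x *\<^sub>R S (sgn x)"
        using False by (simp add: sgn_div_norm blinfun.scaleR_right)
      then show ?thesis
        using *[of "sgn x"] False by (simp add: norm_sgn mult.commute mult_left_mono)
    qed simp
    ultimately have "norm S \<le> norm S - 1 / real (Suc n)"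
      by (rule norm_blinfun_bound)
    then show False
      by (simp add: divide_simps split: if_splits)
  qed
  then obtain x where x: "\<And>n. norm (x n) = 1" "\<And>n. norm S - 1 / real (Suc n) < norm (S (x n))"
    by metis
  have "norm (S (x n)) \<le> norm S" for n
    using norm_blinfun[of S "x n"] x(1) by simp
  then have upper: "\<forall>\<^sub>F n in sequentially. norm (S (x n)) \<le> norm S"
    by simp
  have lower: "\<forall>\<^sub>F n in sequentially. norm S - 1 / real (Suc n) \<le> norm (S (x n))"
    by (intro always_eventually allI less_imp_le x(2))
  have "(\<lambda>n. norm S - 1 / real (Suc n)) \<longlonglongrightarrow> norm S"
    using tendsto_diff[OF tendsto_const LIMSEQ_Suc[OF lim_1_over_n]] by simp
  from tendsto_sandwich[OF lower upper this tendsto_const]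
  have "(\<lambda>n. norm (S (x n))) \<longlonglongrightarrow> norm S" .
  with x(1) show ?thesis
    by (rule that)
qed

text \<open>
  A maximising sequence \<open>x\<close> satisfies \<open>(\<parallel>S\<parallel>\<^sup>2 - S\<^sup>*S) x\<^sub>n \<rightarrow> 0\<close>, so it is weakly null on the range
  of \<open>\<parallel>S\<parallel>\<^sup>2 - S\<^sup>*S\<close>.  If this operator were injective, its range would be dense and \<open>x\<close> weakly null.
\<close>

lemma norm_attained_if_weakly_null_bound:
  fixes S :: "'a::{real_inner, complete_space} \<Rightarrow>\<^sub>L 'a"
  assumes bnd: "weakly_null_bound S r" and r: "0 \<le> r" "r < norm S"
  obtains e where "norm e = 1" "\<And>y. inner (S e) (S y) = (norm S)\<^sup>2 * inner e y"
proof -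
  \<comment> \<open>\<open>Q\<close> is the positive semidefinite form of the operator
    \<open>norm S\<close> squared minus \<open>S\<^sup>*S\<close>.\<close>
  define Q where "Q x y = (norm S)\<^sup>2 * inner x y - inner (S x) (S y)" for x y
  have "0 < norm S"
    using r by linarith
  then obtain x where x: "\<And>n. norm (x n) = 1" "(\<lambda>n. norm (S (x n))) \<longlonglongrightarrow> norm S"
    using blinfun_norm_maximizing_sequence by blast
  have Q_nonneg: "0 \<le> Q v v" for v
    using power_mono[OF norm_blinfun[of S v], of 2]
    by (simp add: Q_def power2_norm_eq_inner[symmetric] power_mult_distrib)
  \<comment> \<open>Cauchy-Schwarz for the semidefinite form \<open>Q\<close>. The factor
    \<open>Q y y\<close> is replaced by the larger \<open>c\<close>, whose summand 1 keeps it
    positive, so that the minimising \<open>t\<close> can be formed.\<close>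
  have Q_sq_le: "(Q v y)\<^sup>2 \<le> Q v v * ((norm S)\<^sup>2 * inner y y + 1)" for v y
  proof -
    define c where "c = (norm S)\<^sup>2 * inner y y + 1"
    define t where "t = - Q v y / c"
    have "Q y y \<le> c"
      by (simp add: Q_def c_def add_increasing2 diff_le_eq)
    have "0 < c"
      by (simp add: c_def add_nonneg_pos)
    have "0 \<le> Q (v + t *\<^sub>R y) (v + t *\<^sub>R y)"
      by (rule Q_nonneg)
    also have "\<dots> = Q v v + 2 * t * Q v y + t\<^sup>2 * Q y y"
      by (simp add: Q_def blinfun.add_right blinfun.scaleR_right inner_add_left inner_add_right
          inner_commute power2_eq_square algebra_simps)
    also have "\<dots> \<le> Q v v + 2 * t * Q v y + t\<^sup>2 * c"
      using \<open>Q y y \<le> c\<close> by (simp add: mult_left_mono)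
    also have "\<dots> = Q v v - (Q v y)\<^sup>2 / c"
      using \<open>0 < c\<close> by (simp add: t_def power2_eq_square divide_simps)
    finally have "(Q v y)\<^sup>2 \<le> Q v v * c"
      using \<open>0 < c\<close> by (simp add: divide_simps mult.commute)
    then show ?thesis
      by (simp add: c_def)
  qed
  have Q_tendsto: "(\<lambda>n. Q (x n) y) \<longlonglongrightarrow> 0" for y
  proof -
    have "(\<lambda>n. Q (x n) (x n)) \<longlonglongrightarrow> (norm S)\<^sup>2 - (norm S)\<^sup>2"
      using tendsto_diff[OF tendsto_const[of "(norm S)\<^sup>2"] tendsto_power[OF x(2), of 2]] x(1)
      by (simp add: Q_def power2_norm_eq_inner[symmetric])
    then have "(\<lambda>n. Q (x n) (x n) * ((norm S)\<^sup>2 * inner y y + 1)) \<longlonglongrightarrow> 0"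
      by (intro tendsto_mult_left_zero) simp
    then have "(\<lambda>n. (Q (x n) y)\<^sup>2) \<longlonglongrightarrow> 0"
      by (rule tendsto_0_le[where K = 1]) (simp add: Q_sq_le Q_nonneg abs_mult)
    then have "(\<lambda>n. sqrt ((Q (x n) y)\<^sup>2)) \<longlonglongrightarrow> sqrt 0"
      by (rule tendsto_real_sqrt)
    then show ?thesis
      by (simp add: tendsto_rabs_zero_iff)
  qed
  define M where "M = {z. (\<lambda>n. inner z (x n)) \<longlonglongrightarrow> 0}"
  have "subspace M"
    unfolding subspace_def M_def
    by (auto simp: inner_add_left intro: tendsto_add_zero tendsto_mult_right_zero)
  \<comment> \<open>An \<epsilon>/2 argument, uniform in \<open>n\<close> because all
    \<open>x n\<close> are unit vectors.\<close>
  have "closed M"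
    unfolding closed_sequential_limits
  proof (intro allI impI, elim conjE)
    fix z l
    assume z: "\<forall>k. z k \<in> M" "z \<longlonglongrightarrow> l"
    have "(\<lambda>n. inner l (x n)) \<longlonglongrightarrow> 0"
    proof (rule LIMSEQ_I)
      fix \<epsilon> :: real
      assume "0 < \<epsilon>"
      obtain k where k: "norm (z k - l) < \<epsilon> / 2"
        using LIMSEQ_D[OF z(2), of "\<epsilon> / 2"] \<open>0 < \<epsilon>\<close> by auto
      have zk: "(\<lambda>n. inner (z k) (x n)) \<longlonglongrightarrow> 0"
        using z(1) by (simp add: M_def)
      obtain N where N: "\<And>n. N \<le> n \<Longrightarrow> \<bar>inner (z k) (x n)\<bar> < \<epsilon> / 2"
        using LIMSEQ_D[OF zk, of "\<epsilon> / 2"] \<open>0 < \<epsilon>\<close> by auto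
      have "\<bar>inner l (x n)\<bar> < \<epsilon>" if "N \<le> n" for n
        using Cauchy_Schwarz_ineq2[of "z k - l" "x n"] N[OF that] k x(1)
        by (simp add: inner_diff_left)
      then show "\<exists>N. \<forall>n\<ge>N. norm (inner l (x n) - 0) < \<epsilon>"
        by auto
    qed
    then show "l \<in> M"
      by (simp add: M_def)
  qed
  \<comment> \<open>Otherwise \<open>x\<close> would be weakly null, and
    \<open>norm (S (x n))\<close> would eventually lie both below and above the midpoint of
    \<open>r\<close> and \<open>norm S\<close>.\<close>
  have "M \<noteq> UNIV"
  proof
    assume "M = UNIV"
    then have "x \<in> weakly_null_unit_seqs scaleR"
      using x(1) by (auto simp: M_def weakly_null_unit_seqs_real_iff)
    moreover have "r < (r + norm S) / 2"
      using r by simp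
    ultimately have "\<forall>\<^sub>F n in sequentially. norm (S (x n)) < (r + norm S) / 2"
      by (rule weakly_null_boundD[OF bnd])
    moreover have "\<forall>\<^sub>F n in sequentially. (r + norm S) / 2 < norm (S (x n))"
      using r by (intro order_tendstoD(1)[OF x(2)]) simp
    ultimately have "\<forall>\<^sub>F n :: nat in sequentially. False"
      by eventually_elim simp
    then show False
      by simp
  qed
  then obtain z where "z \<notin> M"
    by blast
  obtain p where p: "p \<in> M" "\<And>m. m \<in> M \<Longrightarrow> inner (z - p) m = 0"
    using closed_subspace_projection \<open>closed M\<close> \<open>subspace M\<close> by blast
  define u where "u = z - p"
  have "u \<noteq> 0"
    using p(1) \<open>z \<notin> M\<close> by (auto simp: u_def)
  \<comment> \<open>The vector \<open>a\<close> representing \<open>Q\<close> in its first argument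
    lies in \<open>M\<close> by \<open>Q_tendsto\<close>, whereas \<open>u\<close> is orthogonal to
    \<open>M\<close>.\<close>
  have Qu: "Q u y = 0" for y
  proof -
    have "bounded_linear (\<lambda>v. Q v y)"
      unfolding Q_def
      by (intro bounded_linear_intros bounded_linear_compose[OF bounded_linear_inner_left]
          blinfun.bounded_linear_right)
    then obtain a where a: "\<And>v. Q v y = inner a v"
      using Riesz_representation by blast
    then have "a \<in> M"
      using Q_tendsto[of y] by (simp add: M_def)
    then show ?thesis
      using p(2) a by (simp add: u_def inner_commute)
  qed
  show ?thesis
  proof
    show "norm (sgn u) = 1"
      using \<open>u \<noteq> 0\<close> by (simp add: norm_sgn)
    show "inner (S (sgn u)) (S y) = (norm S)\<^sup>2 * inner (sgn u) y" for y
      using Qu[of y] by (simp add: Q_def sgn_div_norm blinfun.scaleR_right)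
  qed
qed

subsection \<open>Orthonormal sets and singular vectors\<close>

definition orthonormal :: "'a::real_inner set \<Rightarrow> bool" where
  "orthonormal E \<longleftrightarrow> (\<forall>e\<in>E. norm e = 1) \<and> pairwise orthogonal E"

definition orthonormal_proj :: "'a::real_inner set \<Rightarrow> 'a \<Rightarrow> 'a" where
  "orthonormal_proj F x = (\<Sum>e\<in>F. inner e x *\<^sub>R e)"

lemma orthonormal_subset: "orthonormal E \<Longrightarrow> F \<subseteq> E \<Longrightarrow> orthonormal F"
  unfolding orthonormal_def by (meson pairwise_subset subsetD)

lemma orthonormal_insert:
  assumes "orthonormal E" "norm x = 1" "\<And>e. e \<in> E \<Longrightarrow> inner e x = 0"
  shows "orthonormal (insert x E)"
  using assms by (auto simp: orthonormal_def pairwise_insert orthogonal_def inner_commute)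

text \<open>Orthogonality concerns two vectors at a time, and any two in the union of a chain lie in
  a common member.\<close>

lemma orthonormal_Union_chain:
  assumes "subset.chain {E. orthonormal E \<and> E \<subseteq> A} C"
  shows "orthonormal (\<Union>C) \<and> \<Union>C \<subseteq> A"
proof -
  have "pairwise orthogonal (\<Union>C)"
    by (rule pairwise_chain_Union)
      (use assms in \<open>auto simp: orthonormal_def subset_chain_def chain_subset_def\<close>)
  then show ?thesis
    using assms by (auto simp: orthonormal_def subset_chain_def)
qed

text \<open>Zorn's lemma: a unit vector of \<open>A\<close> orthogonal to all of \<open>E\<close>
  could be adjoined to \<open>E\<close>.\<close>

lemma maximal_orthonormal_exists:
  obtains E where "orthonormal E" "E \<subseteq> A"
    "\<And>x. x \<in> A \<Longrightarrow> norm x = 1 \<Longrightarrow> \<exists>e\<in>E. inner e x \<noteq> 0"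
proof -
  obtain E where E: "orthonormal E" "E \<subseteq> A"
    and max: "\<And>F. orthonormal F \<Longrightarrow> F \<subseteq> A \<Longrightarrow> E \<subseteq> F \<Longrightarrow> F = E"
    using subset_Zorn'[of "{E. orthonormal E \<and> E \<subseteq> A}"] orthonormal_Union_chain[of A] by auto
  show ?thesis
  proof (rule that[OF E])
    fix x
    assume x: "x \<in> A" "norm x = 1"
    show "\<exists>e\<in>E. inner e x \<noteq> 0"
    proof (rule ccontr)
      assume *: "\<not> ?thesis"
      then have "orthonormal (insert x E)"
        using E(1) x(2) by (intro orthonormal_insert) auto
      then have "x \<in> E"
        using max[of "insert x E"] E(2) x(1) by auto
      then show False
        using * x(2) by (force simp: norm_eq_sqrt_inner)
    qed
  qed
qed

lemma inner_orthonormal: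
  "orthonormal E \<Longrightarrow> e \<in> E \<Longrightarrow> f \<in> E \<Longrightarrow> inner e f = (if e = f then 1 else 0)"
  by (auto simp: orthonormal_def norm_eq_1 pairwise_def orthogonal_def)

lemma inner_orthonormal_proj_residual:
  assumes "orthonormal F" "finite F" "e \<in> F"
  shows "inner e (x - orthonormal_proj F x) = 0"
proof -
  have "inner e (orthonormal_proj F x) = (\<Sum>f\<in>F. if e = f then inner f x else 0)"
    unfolding orthonormal_proj_def inner_sum_right
    by (intro sum.cong) (auto simp: inner_orthonormal[OF assms(1,3)])
  then show ?thesis
    using assms(2,3) by (simp add: inner_diff_right)
qed

text \<open>The projection and the residual are orthogonal. Bessel's inequality drops the residual;
  the estimate of \<open>T - K\<close> keeps it.\<close>

lemma norm_orthonormal_proj_Pythagorean: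
  assumes "orthonormal F" "finite F"
  shows "(norm x)\<^sup>2 = (\<Sum>e\<in>F. (inner e x)\<^sup>2) + (norm (x - orthonormal_proj F x))\<^sup>2"
proof -
  let ?p = "orthonormal_proj F x"
  have "orthogonal ?p (x - ?p)"
    unfolding orthogonal_def
    by (subst orthonormal_proj_def)
      (simp add: inner_sum_left inner_orthonormal_proj_residual[OF assms])
  then have "(norm x)\<^sup>2 = (norm ?p)\<^sup>2 + (norm (x - ?p))\<^sup>2"
    using norm_add_Pythagorean[of ?p "x - ?p"] by simp
  also have "(norm ?p)\<^sup>2 = (\<Sum>e\<in>F. (norm (inner e x *\<^sub>R e))\<^sup>2)"
    unfolding orthonormal_proj_def
    using assms by (intro norm_sum_Pythagorean)
      (auto simp: orthonormal_def pairwise_def orthogonal_def)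
  also have "\<dots> = (\<Sum>e\<in>F. (inner e x)\<^sup>2)"
    using assms(1) by (intro sum.cong) (auto simp: orthonormal_def)
  finally show ?thesis .
qed

lemma Bessel_inequality:
  "orthonormal F \<Longrightarrow> finite F \<Longrightarrow> (\<Sum>e\<in>F. (inner e x)\<^sup>2) \<le> (norm x)\<^sup>2"
  using norm_orthonormal_proj_Pythagorean[of F x] by simp

text \<open>By Bessel the squared coefficients of any vector are summable, so the coefficients tend
  to 0.\<close>

lemma orthonormal_seq_weakly_null:
  fixes e :: "nat \<Rightarrow> 'a::{real_inner, complete_space}"
  assumes "orthonormal (range e)" "inj e"
  shows "e \<in> weakly_null_unit_seqs scaleR"
proof -
  have "(\<lambda>n. inner a (e n)) \<longlonglongrightarrow> 0" for a
  proof -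
    have "(\<Sum>k<n. (inner (e k) a)\<^sup>2) \<le> (norm a)\<^sup>2" for n
      using Bessel_inequality[OF orthonormal_subset[OF assms(1)], of "e ` {..<n}" a]
      by (simp add: sum.reindex inj_on_subset[OF assms(2)] image_mono)
    then have "summable (\<lambda>k. (inner (e k) a)\<^sup>2)"
      by (intro summableI_nonneg_bounded) auto
    then have "(\<lambda>k. sqrt ((inner (e k) a)\<^sup>2)) \<longlonglongrightarrow> sqrt 0"
      by (intro tendsto_real_sqrt summable_LIMSEQ_zero)
    then show ?thesis
      by (simp add: tendsto_rabs_zero_iff inner_commute)
  qed
  then show ?thesis
    using assms(1) by (auto simp: weakly_null_unit_seqs_real_iff orthonormal_def)
qed

lemma infinite_orthonormal_weakly_null:
  fixes E :: "'a::{real_inner, complete_space} set"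
  assumes "orthonormal E" "infinite E"
  obtains s where "s \<in> weakly_null_unit_seqs scaleR" "range s \<subseteq> E"
proof -
  obtain s :: "nat \<Rightarrow> 'a" where "inj s" "range s \<subseteq> E"
    using infinite_countable_subset[OF assms(2)] by blast
  then show ?thesis
    using orthonormal_seq_weakly_null orthonormal_subset[OF assms(1)] that by blast
qed

text \<open>The second condition says \<open>T\<^sup>*T e = \<parallel>T e\<parallel>\<^sup>2 e\<close>.\<close>

definition singular_vector :: "('a::real_inner \<Rightarrow>\<^sub>L 'b::real_inner) \<Rightarrow> 'a \<Rightarrow> bool" where
  "singular_vector T e \<longleftrightarrow> norm e = 1 \<and> (\<forall>y. inner (T e) (T y) = (norm (T e))\<^sup>2 * inner e y)"

text \<open>Eigenvectors of the symmetric operator \<open>T\<^sup>*T\<close> for distinct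
  eigenvalues are orthogonal.\<close>

lemma singular_vector_orthogonal:
  assumes "singular_vector T e" "singular_vector T f" "norm (T e) \<noteq> norm (T f)"
  shows "inner e f = 0"
proof -
  have "(norm (T e))\<^sup>2 * inner e f = (norm (T f))\<^sup>2 * inner e f"
    using assms(1,2) unfolding singular_vector_def by (metis inner_commute)
  then show ?thesis
    using assms(3) by simp
qed

text \<open>Deflation: composing \<open>T\<close> with the projection off the span of
  \<open>F\<close> gives \<open>S\<close>, which vanishes on \<open>F\<close>, agrees with
  \<open>T\<close> on the complement and inherits the bound \<open>r\<close>. A vector attaining the
  norm of \<open>S\<close> is the required \<open>e\<close>.\<close>

lemma singular_vector_exists:
  fixes T :: "'a::{real_inner, complete_space} \<Rightarrow>\<^sub>L 'a"
  assumes bnd: "weakly_null_bound T r" and "0 \<le> r" "r \<le> \<rho>"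
    and F: "finite F" "orthonormal F" "\<And>e. e \<in> F \<Longrightarrow> singular_vector T e"
    and x: "\<And>e. e \<in> F \<Longrightarrow> inner e x = 0" "\<rho> * norm x < norm (T x)"
  obtains e where "singular_vector T e" "\<And>f. f \<in> F \<Longrightarrow> inner f e = 0" "\<rho> < norm (T e)"
proof -
  define S where "S = Blinfun (\<lambda>y. T (y - orthonormal_proj F y))"
  have S: "S y = T (y - orthonormal_proj F y)" for y
    unfolding S_def orthonormal_proj_def
    by (subst bounded_linear_Blinfun_apply) (auto intro!: bounded_linear_intros
        bounded_linear_compose[OF bounded_linear_scaleR_left]
        bounded_linear_compose[OF blinfun.bounded_linear_right])
  have S_eq_T: "S y = T y" if "\<And>f. f \<in> F \<Longrightarrow> inner f y = 0" for y
    using that by (simp add: S orthonormal_proj_def)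
  have S_F: "S f = 0" if "f \<in> F" for f
  proof -
    have "(\<Sum>e\<in>F. inner e f *\<^sub>R e) = (\<Sum>e\<in>F. if e = f then f else 0)"
      by (intro sum.cong) (auto simp: inner_orthonormal[OF F(2) _ that])
    then show ?thesis
      using F(1) that by (simp add: S orthonormal_proj_def)
  qed
  have "\<rho> * norm x < norm S * norm x"
    using x norm_blinfun[of S x] S_eq_T[of x] by simp
  then have \<rho>: "\<rho> < norm S"
    by (rule mult_right_less_imp_less) simp
  \<comment> \<open>\<open>S\<close> differs from \<open>T\<close> by a finite-rank term, which is
    norm null along \<open>s\<close>. The two halves of the gap between \<open>r\<close> and \<rho>
    absorb both contributions.\<close>
  have "weakly_null_bound S r"
    unfolding weakly_null_bound_def
  proof (intro ballI allI impI)
    fix s :: "nat \<Rightarrow> 'a" and \<rho> :: real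
    assume s: "s \<in> weakly_null_unit_seqs scaleR" and "r < \<rho>"
    then have "\<forall>\<^sub>F n in sequentially. norm (T (s n)) < (r + \<rho>) / 2"
      by (intro weakly_null_boundD[OF bnd]) simp_all
    moreover have "(\<lambda>n. T (orthonormal_proj F (s n))) \<longlonglongrightarrow> T (\<Sum>e\<in>F. 0 *\<^sub>R e)"
      unfolding orthonormal_proj_def
      using s by (intro tendsto_intros) (auto simp: weakly_null_unit_seqs_real_iff)
    then have "\<forall>\<^sub>F n in sequentially. norm (T (orthonormal_proj F (s n))) < (\<rho> - r) / 2"
      using \<open>r < \<rho>\<close> by (intro order_tendstoD(2)[OF tendsto_norm_zero]) auto
    ultimately show "\<forall>\<^sub>F n in sequentially. norm (S (s n)) < \<rho>"
    proof eventually_elim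
      case (elim n)
      then show ?case
        using norm_triangle_ineq4[of "T (s n)" "T (orthonormal_proj F (s n))"]
        by (simp add: S blinfun.diff_right field_simps)
    qed
  qed
  then obtain e where e: "norm e = 1" "\<And>y. inner (S e) (S y) = (norm S)\<^sup>2 * inner e y"
    using norm_attained_if_weakly_null_bound \<open>0 \<le> r\<close> \<open>r \<le> \<rho>\<close> \<rho> by (metis le_less_trans)
  have "norm S \<noteq> 0"
    using \<open>0 \<le> r\<close> \<open>r \<le> \<rho>\<close> \<rho> by linarith
  \<comment> \<open>\<open>S f = 0\<close> makes the left side of the eigenvector equation for
    \<open>e\<close> vanish at \<open>f\<close>.\<close>
  have orth: "inner f e = 0" if "f \<in> F" for f
    using e(2)[of f] S_F[OF that] \<open>norm S \<noteq> 0\<close> by (simp add: inner_commute)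
  then have "S e = T e"
    by (rule S_eq_T)
  have "(norm (S e))\<^sup>2 = (norm S)\<^sup>2"
    using e by (simp add: power2_norm_eq_inner norm_eq_1)
  then have norm_Te: "norm (T e) = norm S"
    by (simp add: \<open>S e = T e\<close>)
  \<comment> \<open>Because \<open>f\<close> is itself an eigenvector of \<open>T\<^sup>*T\<close>.
    Hence \<open>T y\<close> and \<open>S y\<close>, which differ by a combination of the
    \<open>T f\<close>, have the same inner product with \<open>T e\<close>.\<close>
  have TF: "inner (T e) (T f) = 0" if "f \<in> F" for f
    using F(3)[OF that] orth[OF that] by (simp add: singular_vector_def inner_commute)
  have "inner (T e) (T y) = (norm (T e))\<^sup>2 * inner e y" for y
  proof -
    have "inner (T e) (T y) = inner (T e) (S y)"
      using TF by (simp add: S orthonormal_proj_def blinfun.diff_right blinfun.sum_right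
          blinfun.scaleR_right inner_diff_right inner_sum_right)
    then show ?thesis
      using e(2)[of y] by (simp add: \<open>S e = T e\<close> norm_Te)
  qed
  then show ?thesis
    using that[of e] orth \<rho> e(1) by (simp add: singular_vector_def norm_Te)
qed

text \<open>The images of orthonormal singular vectors are again orthogonal, so Pythagoras
  applies.\<close>

lemma norm_singular_combination_sq:
  assumes "finite F" "orthonormal F" "\<And>e. e \<in> F \<Longrightarrow> singular_vector T e"
  shows "(norm (\<Sum>e\<in>F. c e *\<^sub>R T e))\<^sup>2 = (\<Sum>e\<in>F. (c e * norm (T e))\<^sup>2)"
proof -
  have "(norm (\<Sum>e\<in>F. c e *\<^sub>R T e))\<^sup>2 = (\<Sum>e\<in>F. (norm (c e *\<^sub>R T e))\<^sup>2)"
    using assms by (intro norm_sum_Pythagorean)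
      (auto simp: orthonormal_def pairwise_def orthogonal_def singular_vector_def)
  then show ?thesis
    by (simp add: power_mult_distrib)
qed

text \<open>The map is diagonal with singular values \<open>\<bar>c e\<bar> * norm (T e)\<close>, so
  a common bound on these bounds its norm; Bessel controls the coefficients.\<close>

lemma norm_singular_combination_le:
  assumes "finite F" "orthonormal F" "\<And>e. e \<in> F \<Longrightarrow> singular_vector T e"
    and c: "\<And>e. e \<in> F \<Longrightarrow> \<bar>c e\<bar> * norm (T e) \<le> b" and "0 \<le> b"
  shows "norm (\<Sum>e\<in>F. (c e * inner e x) *\<^sub>R T e) \<le> b * norm x"
proof (rule power2_le_imp_le)
  have "(norm (\<Sum>e\<in>F. (c e * inner e x) *\<^sub>R T e))\<^sup>2 = (\<Sum>e\<in>F. (c e * norm (T e))\<^sup>2 * (inner e x)\<^sup>2)"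
    using norm_singular_combination_sq[OF assms(1-3), of "\<lambda>e. c e * inner e x"]
    by (simp add: power_mult_distrib mult_ac)
  also have "\<dots> \<le> (\<Sum>e\<in>F. b\<^sup>2 * (inner e x)\<^sup>2)"
  proof (intro sum_mono mult_right_mono)
    fix e
    assume "e \<in> F"
    then have "\<bar>c e * norm (T e)\<bar> \<le> \<bar>b\<bar>"
      using c \<open>0 \<le> b\<close> by (simp add: abs_mult)
    then show "(c e * norm (T e))\<^sup>2 \<le> b\<^sup>2"
      by (simp add: abs_le_square_iff)
  qed simp
  also have "\<dots> \<le> (b * norm x)\<^sup>2"
    using Bessel_inequality[OF assms(2,1), of x]
    by (simp add: sum_distrib_left[symmetric] power_mult_distrib mult_left_mono)
  finally show "(norm (\<Sum>e\<in>F. (c e * inner e x) *\<^sub>R T e))\<^sup>2 \<le> (b * norm x)\<^sup>2" .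
qed (use \<open>0 \<le> b\<close> in simp)

subsection \<open>Compact operators\<close>

text \<open>The pointwise limits form a bounded operator, and the Cauchy estimate, being uniform on
  the unit ball, passes to the limit in \<open>n\<close>.\<close>

lemma blinfun_Cauchy_convergent:
  fixes K :: "nat \<Rightarrow> 'a::real_normed_vector \<Rightarrow>\<^sub>L 'b::{real_normed_vector, complete_space}"
  assumes "Cauchy K"
  shows "convergent K"
proof -
  have "convergent (\<lambda>n. K n x)" for x
    by (intro Cauchy_convergent bounded_linear.Cauchy[OF blinfun.bounded_linear_left assms])
  then obtain l where l: "\<And>x. (\<lambda>n. K n x) \<longlonglongrightarrow> l x"
    unfolding convergent_def by metis
  obtain B where B: "\<And>n. norm (K n) \<le> B"
    using Cauchy_Bseq[OF assms] BseqE by blast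
  have "norm (l x) \<le> norm x * B" for x
  proof (rule LIMSEQ_le_const2[OF tendsto_norm[OF l]])
    have "norm (K n x) \<le> norm x * B" for n
      using norm_blinfun[of "K n" x] mult_right_mono[OF B[of n], of "norm x"] by (simp add: mult.commute)
    then show "\<exists>N. \<forall>n\<ge>N. norm (K n x) \<le> norm x * B"
      by blast
  qed
  moreover have "l (x + y) = l x + l y" for x y
    using LIMSEQ_unique[OF l[of "x + y"]] tendsto_add[OF l l, of x y] by (simp add: blinfun.add_right)
  moreover have "l (a *\<^sub>R x) = a *\<^sub>R l x" for a x
    using LIMSEQ_unique[OF l[of "a *\<^sub>R x"]] tendsto_scaleR[OF tendsto_const l, of a x]
    by (simp add: blinfun.scaleR_right)
  ultimately have "bounded_linear l"
    by (intro bounded_linear_intro)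
  then have L: "blinfun_apply (Blinfun l) = l"
    by (rule bounded_linear_Blinfun_apply)
  have "K \<longlonglongrightarrow> Blinfun l"
  proof (rule LIMSEQ_I)
    fix e :: real
    assume "0 < e"
    then obtain N where N: "\<And>m n. N \<le> m \<Longrightarrow> N \<le> n \<Longrightarrow> norm (K m - K n) < e / 2"
      using CauchyD[OF assms, of "e / 2"] by auto
    have "norm (K m - Blinfun l) < e" if "N \<le> m" for m
    proof -
      have "norm ((K m - Blinfun l) x) \<le> e / 2 * norm x" for x
      proof (rule LIMSEQ_le_const2)
        show "(\<lambda>n. norm ((K m - K n) x)) \<longlonglongrightarrow> norm ((K m - Blinfun l) x)"
          unfolding blinfun.diff_left L by (intro tendsto_intros l)
        have "norm ((K m - K n) x) \<le> e / 2 * norm x" if "N \<le> n" for n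
          using norm_blinfun[of "K m - K n" x] N[OF \<open>N \<le> m\<close> that]
          by (meson less_imp_le mult_right_mono norm_ge_zero order_trans)
        then show "\<exists>N. \<forall>n\<ge>N. norm ((K m - K n) x) \<le> e / 2 * norm x"
          by blast
      qed
      then have "norm (K m - Blinfun l) \<le> e / 2"
        using \<open>0 < e\<close> by (intro norm_blinfun_bound) auto
      then show ?thesis
        using \<open>0 < e\<close> by simp
    qed
    then show "\<exists>N. \<forall>m\<ge>N. norm (K m - Blinfun l) < e"
      by blast
  qed
  then show ?thesis
    by (auto simp: convergent_def)
qed

lemma bounded_ops_real: "bounded_ops (scaleR :: real \<Rightarrow> 'a::real_normed_vector \<Rightarrow> 'a) = UNIV"
  using bounded_linear.linear[OF blinfun.bounded_linear_right]
  by (auto simp: bounded_ops_def linear_def)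

lemma compact_ops_real_iff:
  "T \<in> compact_ops (scaleR :: real \<Rightarrow> 'a::real_normed_vector \<Rightarrow> 'a) \<longleftrightarrow>
     compact (closure (blinfun_apply T ` cball 0 1))"
  by (simp add: compact_ops_def bounded_ops_real)

text \<open>Together with \<open>compact_ops_realE\<close> this trades the closure of the image for
  any compact set containing the image, which is easier to add, scale and map.\<close>

lemma compact_ops_realI:
  assumes "compact C" "\<And>x. norm x \<le> 1 \<Longrightarrow> blinfun_apply T x \<in> C"
  shows "T \<in> compact_ops scaleR"
proof -
  have "closure (blinfun_apply T ` cball 0 1) \<subseteq> C"
    using assms by (intro closure_minimal compact_imp_closed) auto
  then have "closure (blinfun_apply T ` cball 0 1) = C \<inter> closure (blinfun_apply T ` cball 0 1)"
    by blast
  then show ?thesis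
    unfolding compact_ops_real_iff using compact_Int_closed[OF assms(1) closed_closure] by metis
qed

lemma compact_ops_realE:
  assumes "T \<in> compact_ops scaleR"
  obtains C where "compact C" "\<And>x. norm x \<le> 1 \<Longrightarrow> blinfun_apply T x \<in> C"
proof (rule that)
  show "compact (closure (blinfun_apply T ` cball 0 1))"
    using assms by (simp add: compact_ops_real_iff)
  show "blinfun_apply T x \<in> closure (blinfun_apply T ` cball 0 1)" if "norm x \<le> 1" for x
    using that by (intro closure_subset[THEN subsetD] imageI) simp
qed

lemma subspace_compact_ops_real:
  "subspace (compact_ops (scaleR :: real \<Rightarrow> 'a::real_normed_vector \<Rightarrow> 'a))"
  unfolding subspace_def
proof (intro conjI ballI allI)
  show "0 \<in> compact_ops (scaleR :: real \<Rightarrow> 'a \<Rightarrow> 'a)"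
    by (rule compact_ops_realI[of "{0}"]) auto
next
  fix S T :: "'a \<Rightarrow>\<^sub>L 'a"
  assume "S \<in> compact_ops scaleR" "T \<in> compact_ops scaleR"
  then obtain C D where C: "compact C" "\<And>x. norm x \<le> 1 \<Longrightarrow> S x \<in> C"
    and D: "compact D" "\<And>x. norm x \<le> 1 \<Longrightarrow> T x \<in> D"
    by (metis compact_ops_realE)
  show "S + T \<in> compact_ops scaleR"
    by (rule compact_ops_realI[OF compact_sums[OF C(1) D(1)]]) (use C D in \<open>auto simp: blinfun.add_left\<close>)
next
  fix c and T :: "'a \<Rightarrow>\<^sub>L 'a"
  assume "T \<in> compact_ops scaleR"
  then obtain D where D: "compact D" "\<And>x. norm x \<le> 1 \<Longrightarrow> T x \<in> D"
    by (metis compact_ops_realE)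
  show "c *\<^sub>R T \<in> compact_ops scaleR"
    by (rule compact_ops_realI[OF compact_scaling[OF D(1)]]) (use D in \<open>auto simp: blinfun.scaleR_left\<close>)
qed

text \<open>A finite net for the image of the unit ball under a nearby compact \<open>S\<close> is
  also a net, slightly coarser, for its image under \<open>T\<close>.\<close>

lemma closed_compact_ops_real:
  "closed (compact_ops (scaleR :: real \<Rightarrow> 'a::{real_normed_vector, complete_space} \<Rightarrow> 'a))"
proof -
  have "T \<in> compact_ops scaleR"
    if *: "\<And>e. 0 < e \<Longrightarrow> \<exists>S\<in>compact_ops scaleR. dist S T < e" for T :: "'a \<Rightarrow>\<^sub>L 'a"
    unfolding compact_ops_real_iff compact_eq_totally_bounded
  proof (intro conjI allI impI)
    show "complete (closure (blinfun_apply T ` cball 0 1))"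
      by (simp add: complete_eq_closed)
    fix e :: real
    assume "0 < e"
    then obtain S where S: "S \<in> compact_ops scaleR" "dist S T < e / 4"
      using *[of "e / 4"] by auto
    obtain C where C: "compact C" "\<And>x. norm x \<le> 1 \<Longrightarrow> S x \<in> C"
      using compact_ops_realE[OF S(1)] by blast
    obtain k where k: "finite k" "C \<subseteq> (\<Union>x\<in>k. ball x (e / 4))"
      using C(1) \<open>0 < e\<close> unfolding compact_eq_totally_bounded by (metis zero_less_divide_iff zero_less_numeral)
    \<comment> \<open>Closed balls of radius \<open>e / 2\<close> let the inclusion pass to the
      closure; they are then enlarged to open balls of radius \<open>e\<close>.\<close>
    have "closure (blinfun_apply T ` cball 0 1) \<subseteq> (\<Union>x\<in>k. cball x (e / 2))"
    proof (rule closure_minimal)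
      show "blinfun_apply T ` cball 0 1 \<subseteq> (\<Union>x\<in>k. cball x (e / 2))"
      proof clarify
        fix x :: 'a
        assume "x \<in> cball 0 1"
        then have "norm x \<le> 1"
          by simp
        then have "S x \<in> (\<Union>y\<in>k. ball y (e / 4))"
          using C(2) k(2) by blast
        then obtain y where y: "y \<in> k" "dist y (S x) < e / 4"
          by auto
        have "dist (S x) (T x) \<le> norm (S - T) * norm x"
          using norm_blinfun[of "S - T" x] by (simp add: dist_norm blinfun.diff_left)
        also have "\<dots> \<le> norm (S - T)"
          using \<open>norm x \<le> 1\<close> by (simp add: mult_left_le)
        finally have "dist y (T x) \<le> e / 2"
          using y(2) S(2) dist_triangle[of y "T x" "S x"] by (simp add: dist_norm[of S T])
        then show "T x \<in> (\<Union>x\<in>k. cball x (e / 2))"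
          using y(1) by auto
      qed
    qed (use k(1) in auto)
    also have "\<dots> \<subseteq> (\<Union>x\<in>k. ball x e)"
      using \<open>0 < e\<close> by force
    finally show "\<exists>k. finite k \<and> closure (blinfun_apply T ` cball 0 1) \<subseteq> (\<Union>x\<in>k. ball x e)"
      using k(1) by blast
  qed
  then show ?thesis
    unfolding closure_subset_eq[symmetric] closure_approachable by (auto simp: closure_approachable)
qed

lemma rank_one_compact:
  "blinfun_scaleR_left b o\<^sub>L blinfun_inner_right a \<in> compact_ops (scaleR :: real \<Rightarrow> 'a::real_inner \<Rightarrow> 'a)"
proof (rule compact_ops_realI)
  show "compact ((\<lambda>t. t *\<^sub>R b) ` {- norm a..norm a})"
    by (intro compact_continuous_image continuous_intros compact_Icc)
  fix x :: 'a
  assume "norm x \<le> 1"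
  then have "\<bar>inner a x\<bar> \<le> norm a"
    using Cauchy_Schwarz_ineq2[of a x] mult_left_le[of "norm x" "norm a"] by simp
  then show "(blinfun_scaleR_left b o\<^sub>L blinfun_inner_right a) x \<in> (\<lambda>t. t *\<^sub>R b) ` {- norm a..norm a}"
    by (auto intro!: imageI)
qed

text \<open>Along a subsequence bounded away from 0, compactness yields a norm limit
  \<open>l\<close> of the images. They also tend weakly to 0, so \<open>l = 0\<close>, a
  contradiction.\<close>

lemma compact_op_weakly_null:
  fixes K :: "'a::{real_inner, complete_space} \<Rightarrow>\<^sub>L 'a"
  assumes "K \<in> compact_ops scaleR" "s \<in> weakly_null_unit_seqs scaleR"
  shows "(\<lambda>n. K (s n)) \<longlonglongrightarrow> 0"
proof (rule ccontr)
  assume "\<not> ?thesis"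
  then obtain \<epsilon> where \<epsilon>: "0 < \<epsilon>" "\<exists>\<^sub>F n in sequentially. \<epsilon> \<le> norm (K (s n))"
    by (auto simp: tendsto_iff frequently_def not_le)
  define A where "A = {n. \<epsilon> \<le> norm (K (s n))}"
  have "infinite A"
    using \<epsilon>(2) by (simp add: A_def frequently_cofinite cofinite_eq_sequentially[symmetric])
  then obtain f :: "nat \<Rightarrow> nat" where f: "strict_mono f" "\<And>n. f n \<in> A"
    using infinite_enumerate by blast
  obtain C where C: "compact C" "\<And>x. norm x \<le> 1 \<Longrightarrow> K x \<in> C"
    using compact_ops_realE[OF assms(1)] by blast
  have s: "norm (s n) = 1" "(\<lambda>n. inner a (s n)) \<longlonglongrightarrow> 0" for n a
    using assms(2) by (simp_all add: weakly_null_unit_seqs_real_iff)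
  have "\<forall>n. (K \<circ> s \<circ> f) n \<in> C"
    by (simp add: C(2) s(1))
  then obtain l g where g: "strict_mono g" "(K \<circ> s \<circ> f \<circ> g) \<longlonglongrightarrow> l"
    using seq_compactE[OF C(1)[unfolded compact_eq_seq_compact_metric]] by (metis comp_assoc)
  \<comment> \<open>\<open>a\<close> is the adjoint of \<open>K\<close> applied to
    \<open>l\<close>.\<close>
  obtain a where a: "\<And>x. inner l (K x) = inner a x"
    using Riesz_representation[of "\<lambda>x. inner l (K x)"]
      bounded_linear_compose[OF bounded_linear_inner_right blinfun.bounded_linear_right] by blast
  have "(\<lambda>n. inner l ((K \<circ> s \<circ> f \<circ> g) n)) \<longlonglongrightarrow> 0"
    using LIMSEQ_subseq_LIMSEQ[OF s(2)[of a] strict_mono_o[OF f(1) g(1)]] by (simp add: a o_def)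
  moreover have "(\<lambda>n. inner l ((K \<circ> s \<circ> f \<circ> g) n)) \<longlonglongrightarrow> inner l l"
    by (intro tendsto_intros g(2))
  ultimately have "l = 0"
    using LIMSEQ_unique by (metis inner_eq_zero_iff)
  then have "(\<lambda>n. norm ((K \<circ> s \<circ> f \<circ> g) n)) \<longlonglongrightarrow> 0"
    using tendsto_norm[OF g(2)] by simp
  moreover have "\<epsilon> \<le> norm ((K \<circ> s \<circ> f \<circ> g) n)" for n
    using f(2) by (simp add: A_def)
  ultimately have "\<epsilon> \<le> 0"
    by (intro LIMSEQ_le_const) auto
  with \<open>0 < \<epsilon>\<close> show False
    by simp
qed

subsection \<open>The compact approximant\<close>

lemma norm_limit_le:
  fixes K :: "nat \<Rightarrow> 'a::real_normed_vector"
  assumes "K \<longlonglongrightarrow> L" "\<And>n. norm (K n - a) \<le> b + 1 / real (Suc n)"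
  shows "norm (L - a) \<le> b"
proof (rule LIMSEQ_le)
  show "(\<lambda>n. norm (K n - a)) \<longlonglongrightarrow> norm (L - a)"
    by (intro tendsto_intros assms(1))
  show "(\<lambda>n. b + 1 / real (Suc n)) \<longlonglongrightarrow> b"
    using tendsto_add[OF tendsto_const LIMSEQ_Suc[OF lim_1_over_n], of b] by simp
qed (use assms(2) in blast)

text \<open>
  In terms of the polar decomposition \<open>T = U |T|\<close>, the operator built here is
  \<open>K = U (|T| - r)\<^sup>+\<close>, and \<open>T - K = U min(|T|, r)\<close>.
\<close>

lemma compact_approximant_real:
  fixes T :: "'a::{real_inner, complete_space} \<Rightarrow>\<^sub>L 'a"
  assumes bnd: "weakly_null_bound T r" and "0 \<le> r" and r: "norm T - 1 \<le> r"
  obtains K where "K \<in> compact_ops scaleR" "norm K \<le> 1" "norm (T - K) \<le> r"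
proof -
  obtain E where E: "orthonormal E" "E \<subseteq> {e. singular_vector T e \<and> r < norm (T e)}"
    and max: "\<And>x. x \<in> {e. singular_vector T e \<and> r < norm (T e)} \<Longrightarrow> norm x = 1 \<Longrightarrow> \<exists>e\<in>E. inner e x \<noteq> 0"
    by (rule maximal_orthonormal_exists) blast
  have sing: "singular_vector T e" and gt: "r < norm (T e)" and unit: "norm e = 1" if "e \<in> E" for e
    using E(2) that by (auto simp: singular_vector_def)
  define F where "F \<delta> = {e \<in> E. r + \<delta> \<le> norm (T e)}" for \<delta>
  have F_E: "F \<delta> \<subseteq> E" for \<delta>
    by (auto simp: F_def)
  have F_orth: "orthonormal (F \<delta>)" for \<delta>
    using orthonormal_subset[OF E(1) F_E] .
  \<comment> \<open>An infinite \<open>F \<delta>\<close> would contain a weakly null sequence on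
    which \<open>norm (T e)\<close> stays at least \<open>r + \<delta>\<close>.\<close>
  have F_fin: "finite (F \<delta>)" if "0 < \<delta>" for \<delta>
  proof (rule ccontr)
    assume "infinite (F \<delta>)"
    then obtain s where s: "s \<in> weakly_null_unit_seqs scaleR" "range s \<subseteq> F \<delta>"
      using infinite_orthonormal_weakly_null[OF F_orth] by blast
    have "\<forall>\<^sub>F n in sequentially. norm (T (s n)) < r + \<delta>"
      using weakly_null_boundD[OF bnd s(1)] that by simp
    then obtain n where "norm (T (s n)) < r + \<delta>"
      using eventually_happens' sequentially_bot by blast
    moreover have "s n \<in> F \<delta>"
      using s(2) by blast
    ultimately show False
      by (simp add: F_def)
  qed
  \<comment> \<open>Otherwise deflation by \<open>F \<delta>\<close> yields a new singular vector
    with value above \<open>r + \<delta>\<close>. It is orthogonal also to the rest of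
    \<open>E\<close>, whose values are smaller, against maximality.\<close>
  have T_le: "norm (T x) \<le> (r + \<delta>) * norm x"
    if "0 < \<delta>" and x: "\<And>e. e \<in> F \<delta> \<Longrightarrow> inner e x = 0" for \<delta> x
  proof (rule ccontr)
    assume "\<not> ?thesis"
    then obtain e where e: "singular_vector T e" "\<And>f. f \<in> F \<delta> \<Longrightarrow> inner f e = 0"
      "r + \<delta> < norm (T e)"
      using singular_vector_exists[OF bnd \<open>0 \<le> r\<close> _ F_fin[OF \<open>0 < \<delta>\<close>] F_orth _ x, of "r + \<delta>"]
        \<open>0 < \<delta>\<close> sing F_E by (metis less_add_same_cancel1 less_imp_le not_le subsetD)
    have "inner f e = 0" if "f \<in> E" for f
      using e that singular_vector_orthogonal[OF sing[OF that] e(1)] by (cases "f \<in> F \<delta>") (auto simp: F_def)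
    then show False
      using max[of e] e(1,3) \<open>0 < \<delta>\<close> by (auto simp: singular_vector_def)
  qed
  \<comment> \<open>The factor that lowers the singular value \<open>norm (T e)\<close> to
    \<open>norm (T e) - r\<close>.\<close>
  define c where "c e = 1 - r / norm (T e)" for e
  have c_norm: "\<bar>c e\<bar> * norm (T e) = norm (T e) - r" if "e \<in> E" for e
  proof -
    have "0 < norm (T e)"
      using gt[OF that] \<open>0 \<le> r\<close> by linarith
    then have "\<bar>c e\<bar> = 1 - r / norm (T e)"
      using gt[OF that] by (simp add: c_def)
    then show ?thesis
      using \<open>0 < norm (T e)\<close> by (simp add: left_diff_distrib)
  qed
  define G where "G n = F (1 / real (Suc n))" for n
  have G: "finite (G n)" "orthonormal (G n)" "G n \<subseteq> E" for n
    unfolding G_def by (intro F_fin F_orth F_E; simp)+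
  have G_sing: "singular_vector T e" if "e \<in> G n" for e n
    using that G(3) sing by blast
  define K where "K n = (\<Sum>e\<in>G n. c e *\<^sub>R (blinfun_scaleR_left (T e) o\<^sub>L blinfun_inner_right e))" for n
  have K: "K n x = (\<Sum>e\<in>G n. (c e * inner e x) *\<^sub>R T e)" for n x
    by (simp add: K_def blinfun.sum_left blinfun.scaleR_left)
  \<comment> \<open>Vectors in \<open>G m - G n\<close> have \<open>norm (T e)\<close> between
    \<open>r\<close> and \<open>r + 1 / real (Suc n)\<close>, so their lowered singular values are
    at most \<open>1 / real (Suc n)\<close>.\<close>
  have norm_K_diff: "norm (K m - K n) \<le> 1 / real (Suc n)" if "n \<le> m" for m n
  proof (rule norm_blinfun_bound)
    fix x
    have "1 / real (Suc m) \<le> 1 / real (Suc n)"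
      using that by (simp add: frac_le)
    then have "G n \<subseteq> G m"
      by (auto simp: G_def F_def)
    then have "(K m - K n) x = (\<Sum>e\<in>G m - G n. (c e * inner e x) *\<^sub>R T e)"
      using G(1) by (simp add: blinfun.diff_left K sum_diff)
    also have "norm \<dots> \<le> 1 / real (Suc n) * norm x"
    proof (rule norm_singular_combination_le)
      show "orthonormal (G m - G n)"
        using G(2) by (rule orthonormal_subset) blast
      fix e
      assume e: "e \<in> G m - G n"
      then have "e \<in> E" "norm (T e) \<le> r + 1 / real (Suc n)"
        using G(3) by (auto simp: G_def F_def)
      then show "\<bar>c e\<bar> * norm (T e) \<le> 1 / real (Suc n)"
        using c_norm by simp
    qed (use G G_sing in auto)
    finally show "norm ((K m - K n) x) \<le> 1 / real (Suc n) * norm x" .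
  qed simp
  \<comment> \<open>The singular values of \<open>K n\<close> are at most \<open>norm T - r\<close>,
    hence at most 1. The subtracted 0 and the slack fit \<open>norm_limit_le\<close>.\<close>
  have norm_K: "norm (K n - 0) \<le> 1 + 1 / real (Suc n)" for n
  proof -
    have "norm (K n) \<le> 1"
    proof (rule norm_blinfun_bound)
      fix x
      show "norm (K n x) \<le> 1 * norm x"
        unfolding K
      proof (rule norm_singular_combination_le)
        fix e
        assume "e \<in> G n"
        then have "e \<in> E"
          using G(3) by blast
        then show "\<bar>c e\<bar> * norm (T e) \<le> 1"
          using c_norm[of e] norm_blinfun[of T e] unit[of e] r by simp
      qed (use G G_sing in auto)
    qed simp
    then show ?thesis
      by (simp add: add_increasing2)
  qed
  have norm_T_K: "norm (K n - T) \<le> r + 1 / real (Suc n)" for n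
  proof (rule norm_blinfun_bound)
    define \<rho> where "\<rho> = r + 1 / real (Suc n)"
    have "r \<le> \<rho>"
      by (simp add: \<rho>_def)
    show "0 \<le> r + 1 / real (Suc n)"
      using \<open>0 \<le> r\<close> by simp
    fix x
    \<comment> \<open>\<open>T - K n\<close> has singular value \<open>r\<close> on the span of
      \<open>G n\<close> and equals \<open>T\<close> on the residual \<open>y\<close>. The two image
      parts \<open>?s\<close> and \<open>T y\<close> are orthogonal, so their squares add.\<close>
    define y where "y = x - orthonormal_proj (G n) x"
    let ?s = "\<Sum>e\<in>G n. (r / norm (T e) * inner e x) *\<^sub>R T e"
    have "T x = T (orthonormal_proj (G n) x) + T y"
      by (simp add: y_def blinfun.diff_right)
    then have "T x - K n x = (\<Sum>e\<in>G n. inner e x *\<^sub>R T e - (c e * inner e x) *\<^sub>R T e) + T y"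
      by (simp add: K orthonormal_proj_def blinfun.sum_right blinfun.scaleR_right sum_subtractf)
    also have "(\<Sum>e\<in>G n. inner e x *\<^sub>R T e - (c e * inner e x) *\<^sub>R T e) = ?s"
      by (intro sum.cong) (simp_all add: c_def algebra_simps)
    finally have split: "T x - K n x = ?s + T y" .
    have y: "inner e y = 0" if "e \<in> G n" for e
      unfolding y_def using G that by (intro inner_orthonormal_proj_residual)
    have "orthogonal ?s (T y)"
      using G_sing y by (auto simp: orthogonal_def inner_sum_left singular_vector_def)
    then have sq: "(norm (T x - K n x))\<^sup>2 = (norm ?s)\<^sup>2 + (norm (T y))\<^sup>2"
      unfolding split by (rule norm_add_Pythagorean)
    have "(norm ?s)\<^sup>2 = (\<Sum>e\<in>G n. (r / norm (T e) * inner e x * norm (T e))\<^sup>2)"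
      by (intro norm_singular_combination_sq G G_sing)
    also have "\<dots> = (\<Sum>e\<in>G n. r\<^sup>2 * (inner e x)\<^sup>2)"
    proof (intro sum.cong refl)
      fix e
      assume "e \<in> G n"
      then have "norm (T e) \<noteq> 0"
        using G(3) gt \<open>0 \<le> r\<close> by force
      then show "(r / norm (T e) * inner e x * norm (T e))\<^sup>2 = r\<^sup>2 * (inner e x)\<^sup>2"
        by (simp add: power_mult_distrib)
    qed
    \<comment> \<open>Weakening \<open>r\<close> to \<rho> gives both parts the same factor, so that
      Pythagoras for \<open>x\<close> recombines them.\<close>
    also have "\<dots> \<le> (\<Sum>e\<in>G n. \<rho>\<^sup>2 * (inner e x)\<^sup>2)"
      using \<open>0 \<le> r\<close> \<open>r \<le> \<rho>\<close> by (intro sum_mono mult_right_mono power_mono) auto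
    finally have s_le: "(norm ?s)\<^sup>2 \<le> (\<Sum>e\<in>G n. \<rho>\<^sup>2 * (inner e x)\<^sup>2)" .
    have Ty_le: "(norm (T y))\<^sup>2 \<le> (\<rho> * norm y)\<^sup>2"
      using T_le[of "1 / real (Suc n)" y] y by (intro power_mono) (simp_all add: \<rho>_def G_def)
    have "(\<Sum>e\<in>G n. \<rho>\<^sup>2 * (inner e x)\<^sup>2) + (\<rho> * norm y)\<^sup>2 = (\<rho> * norm x)\<^sup>2"
      using norm_orthonormal_proj_Pythagorean[OF G(2)[of n] G(1), of x]
      by (simp add: y_def power_mult_distrib sum_distrib_left[symmetric] distrib_left)
    with sq s_le Ty_le have "(norm (T x - K n x))\<^sup>2 \<le> (\<rho> * norm x)\<^sup>2"
      by linarith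
    then have "norm (T x - K n x) \<le> \<rho> * norm x"
      by (rule power2_le_imp_le) (use \<open>0 \<le> r\<close> \<open>r \<le> \<rho>\<close> in simp)
    then show "norm ((K n - T) x) \<le> (r + 1 / real (Suc n)) * norm x"
      by (simp add: blinfun.diff_left norm_minus_commute \<rho>_def)
  qed
  have "Cauchy K"
  proof (rule metric_CauchyI)
    fix e :: real
    assume "0 < e"
    then obtain N where N: "1 / real (Suc N) < e"
      using nat_approx_posE by blast
    have *: "dist (K m) (K n) < e" if "N \<le> n" "n \<le> m" for m n
    proof -
      have "1 / real (Suc n) \<le> 1 / real (Suc N)"
        using that by (simp add: frac_le)
      then show ?thesis
        using norm_K_diff[OF that(2)] N by (simp add: dist_norm)
    qed
    have "dist (K m) (K n) < e" if "N \<le> m" "N \<le> n" for m n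
      using *[of m n] *[of n m] that by (cases "n \<le> m") (auto simp: dist_commute)
    then show "\<exists>N. \<forall>m\<ge>N. \<forall>n\<ge>N. dist (K m) (K n) < e"
      by blast
  qed
  then obtain L where L: "K \<longlonglongrightarrow> L"
    using blinfun_Cauchy_convergent convergent_def by blast
  show ?thesis
  proof
    have "K n \<in> compact_ops scaleR" for n
      unfolding K_def
      by (intro subspace_sum[OF subspace_compact_ops_real] subspace_scale[OF subspace_compact_ops_real]
          rank_one_compact)
    then show "L \<in> compact_ops scaleR"
      using closed_compact_ops_real L closed_sequentially by blast
    show "norm L \<le> 1"
      using norm_limit_le[OF L norm_K] by simp
    show "norm (T - L) \<le> r"
      using norm_limit_le[OF L norm_T_K] by (simp add: norm_minus_commute)
  qed
qed

subsection \<open>The distance formula\<close>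

text \<open>A limsup bound quantifies over extended real levels; beyond the real ones only infinity
  lies above \<open>ereal r\<close>, and there the condition is trivial.\<close>

lemma Delta_le_iff: "Delta scaleR T \<le> ereal r \<longleftrightarrow> weakly_null_bound T r"
proof -
  have "limsup (\<lambda>n. ereal (norm (T (s n)))) \<le> ereal r \<longleftrightarrow>
      (\<forall>\<rho>>r. \<forall>\<^sub>F n in sequentially. norm (T (s n)) < \<rho>)" for s
  proof -
    have "(\<forall>y>ereal r. \<forall>\<^sub>F n in sequentially. ereal (norm (T (s n))) < y) \<longleftrightarrow>
      (\<forall>\<rho>>r. \<forall>\<^sub>F n in sequentially. norm (T (s n)) < \<rho>)"
    proof (intro iffI allI impI)
      fix y
      assume *: "\<forall>\<rho>>r. \<forall>\<^sub>F n in sequentially. norm (T (s n)) < \<rho>" and "ereal r < y"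
      then show "\<forall>\<^sub>F n in sequentially. ereal (norm (T (s n))) < y"
        by (cases y) auto
    next
      fix \<rho>
      assume *: "\<forall>y>ereal r. \<forall>\<^sub>F n in sequentially. ereal (norm (T (s n))) < y" and "r < \<rho>"
      then show "\<forall>\<^sub>F n in sequentially. norm (T (s n)) < \<rho>"
        using *[rule_format, of "ereal \<rho>"] by simp
    qed
    then show ?thesis
      by (simp add: Limsup_le_iff)
  qed
  then show ?thesis
    by (simp add: Delta_def SUP_le_iff weakly_null_bound_def)
qed

text \<open>\<open>K\<close> is norm null along the sequence, so only \<open>T - K\<close>
  contributes in the limit. This is the lower bound of both distances by
  \<open>Delta\<close>.\<close>

lemma weakly_null_bound_compact_distance:
  assumes "K \<in> compact_ops scaleR"
  shows "weakly_null_bound T (norm (T - K))"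
  unfolding weakly_null_bound_def
proof (intro ballI allI impI)
  fix s :: "nat \<Rightarrow> 'a" and \<rho>
  assume s: "s \<in> weakly_null_unit_seqs scaleR" and \<rho>: "norm (T - K) < \<rho>"
  have "\<forall>\<^sub>F n in sequentially. norm (K (s n)) < \<rho> - norm (T - K)"
    using \<rho> by (intro order_tendstoD(2)[OF tendsto_norm_zero[OF compact_op_weakly_null[OF assms s]]]) simp
  then show "\<forall>\<^sub>F n in sequentially. norm (T (s n)) < \<rho>"
  proof eventually_elim
    case (elim n)
    have "norm ((T - K) (s n)) \<le> norm (T - K)"
      using norm_blinfun[of "T - K" "s n"] s by (simp add: weakly_null_unit_seqs_real_iff)
    then show ?case
      using elim norm_triangle_ineq[of "(T - K) (s n)" "K (s n)"] by (simp add: blinfun.diff_left)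
  qed
qed

text \<open>The set \<open>C\<close> stands for the compact operators over either scalar field. An
  approximant at the level \<open>r\<close> of the lower bound gives the distance and a nearest
  point at once.\<close>

lemma compact_distance_formula:
  fixes T :: "'a::{real_inner, complete_space} \<Rightarrow>\<^sub>L 'a"
  assumes C: "C \<subseteq> compact_ops scaleR" "0 \<in> C"
    and nonempty: "weakly_null_unit_seqs (scaleR :: real \<Rightarrow> 'a \<Rightarrow> 'a) \<noteq> {}"
    and approximant: "\<And>r. weakly_null_bound T r \<Longrightarrow> 0 \<le> r \<Longrightarrow> norm T - 1 \<le> r \<Longrightarrow>
      \<exists>K\<in>C. norm K \<le> 1 \<and> norm (T - K) \<le> r"
  shows "ereal (infdist T (C \<inter> cball 0 1)) = max (ereal (norm T - 1)) (Delta scaleR T)"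
    and "max (ereal (norm T - 1)) (Delta scaleR T) = ereal (max (norm T - 1) (infdist T C))"
    and "\<exists>K \<in> C \<inter> cball 0 1. norm (T - K) = infdist T (C \<inter> cball 0 1)"
proof -
  have Delta_le: "Delta scaleR T \<le> ereal (norm (T - K))" if "K \<in> C" for K
    using weakly_null_bound_compact_distance C(1) that by (auto simp: Delta_le_iff)
  obtain s :: "nat \<Rightarrow> 'a" where s: "s \<in> weakly_null_unit_seqs scaleR"
    using nonempty by blast
  \<comment> \<open>The existing sequence keeps the supremum from being minus infinity, and
    \<open>0 \<in> C\<close> bounds it by \<open>norm T\<close>; hence \<open>Delta\<close> is a
    real number \<open>d\<close>.\<close>
  have "0 \<le> limsup (\<lambda>n. ereal (norm (T (s n))))"
    by (intro le_Limsup) auto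
  also have "\<dots> \<le> Delta scaleR T"
    unfolding Delta_def by (intro SUP_upper s)
  finally have "0 \<le> Delta scaleR T" .
  moreover have "Delta scaleR T \<le> ereal (norm T)"
    using Delta_le[OF C(2)] by simp
  ultimately obtain d where d: "Delta scaleR T = ereal d" "0 \<le> d"
    by (cases "Delta scaleR T") auto
  define r where "r = max (norm T - 1) d"
  have "weakly_null_bound T r"
    using d by (simp add: Delta_le_iff[symmetric] r_def)
  moreover have "0 \<le> r" "norm T - 1 \<le> r"
    using d(2) by (simp_all add: r_def)
  ultimately obtain K where K: "K \<in> C" "norm K \<le> 1" "norm (T - K) \<le> r"
    using approximant by blast
  have d_le: "d \<le> dist T K'" if "K' \<in> C" for K'
    using Delta_le[OF that] d(1) by (simp add: dist_norm)
  have "r \<le> dist T K'" if "K' \<in> C \<inter> cball 0 1" for K'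
    using d_le[of K'] that norm_triangle_ineq2[of T K'] by (simp add: r_def dist_norm)
  then have "r \<le> infdist T (C \<inter> cball 0 1)"
    using K(1,2) by (subst infdist_notempty) (auto intro!: cINF_greatest)
  moreover have le_dist: "infdist T (C \<inter> cball 0 1) \<le> dist T K"
    using K by (intro infdist_le) auto
  ultimately have infdist_ball: "infdist T (C \<inter> cball 0 1) = r" and norm_K: "norm (T - K) = r"
    using K(3) by (simp_all add: dist_norm)
  have "d \<le> infdist T C"
    using C(2) d_le by (subst infdist_notempty) (auto intro!: cINF_greatest)
  moreover have "infdist T C \<le> r"
    unfolding infdist_ball[symmetric] using K(1,2) by (intro infdist_mono) auto
  \<comment> \<open>The distance to \<open>C\<close> lies between \<open>d\<close> and
    \<open>r\<close>, and \<open>r\<close> is the maximum of \<open>norm T - 1\<close> and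
    \<open>d\<close>.\<close>
  ultimately have "max (norm T - 1) (infdist T C) = r"
    by (auto simp: r_def max_def)
  then show "max (ereal (norm T - 1)) (Delta scaleR T) = ereal (max (norm T - 1) (infdist T C))"
    by (simp add: d(1) r_def ereal_max)
  show "ereal (infdist T (C \<inter> cball 0 1)) = max (ereal (norm T - 1)) (Delta scaleR T)"
    by (simp add: infdist_ball d(1) r_def ereal_max)
  show "\<exists>K \<in> C \<inter> cball 0 1. norm (T - K) = infdist T (C \<inter> cball 0 1)"
    using K norm_K infdist_ball by auto
qed

text \<open>A finite maximal real-orthonormal set would span the space over the reals, hence over
  the field of \<open>scl\<close>, and so contain a finite basis. The general \<open>scl\<close>
  covers both notions of dimension.\<close>

lemma weakly_null_unit_seqs_nonempty:
  fixes scl :: "'k::field \<Rightarrow> 'a::{real_inner, complete_space} \<Rightarrow> 'a"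
  assumes "vector_space scl" "infinite_dimensional scl"
    and scaleR: "\<And>r x. \<exists>k. r *\<^sub>R x = scl k x"
  shows "weakly_null_unit_seqs (scaleR :: real \<Rightarrow> 'a \<Rightarrow> 'a) \<noteq> {}"
proof -
  interpret vector_space scl
    by fact
  obtain E :: "'a set" where E: "orthonormal E" "\<And>x. norm x = 1 \<Longrightarrow> \<exists>e\<in>E. inner e x \<noteq> 0"
    using maximal_orthonormal_exists[of UNIV] by auto
  have "infinite E"
  proof
    assume "finite E"
    have "x \<in> span E" for x
    proof -
      define y where "y = x - orthonormal_proj E x"
      have "inner e (sgn y) = 0" if "e \<in> E" for e
        using inner_orthonormal_proj_residual[OF E(1) \<open>finite E\<close> that, of x]
        by (simp add: sgn_div_norm y_def)
      then have "y = 0"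
        using E(2)[of "sgn y"] norm_sgn[of y] by (cases "y = 0") auto
      then have "x = (\<Sum>e\<in>E. inner e x *\<^sub>R e)"
        by (simp add: y_def orthonormal_proj_def)
      also have "\<dots> \<in> span E"
        by (intro span_sum) (metis scaleR span_base span_scale)
      finally show ?thesis .
    qed
    obtain B where B: "B \<subseteq> E" "independent B" "E \<subseteq> span B"
      using maximal_independent_subset[of E] by blast
    have "span B = UNIV"
      using B(3) \<open>\<And>x. x \<in> span E\<close> span_minimal[OF B(3) subspace_span] by blast
    then have "finite_dimensional_vector_space scl B"
      using B finite_subset[OF B(1) \<open>finite E\<close>] by unfold_locales auto
    then show False
      using assms(2) by (auto simp: infinite_dimensional_def)
  qed
  with E(1) obtain s :: "nat \<Rightarrow> 'a" where "s \<in> weakly_null_unit_seqs scaleR"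
    by (rule infinite_orthonormal_weakly_null)
  then show ?thesis
    by (metis empty_iff)
qed

subsection \<open>Complex scalars\<close>

lemma vector_space_scaleC: "vector_space (scaleC :: complex \<Rightarrow> 'a::complex_inner \<Rightarrow> 'a)"
  by unfold_locales (simp_all add: scaleC_add_right scaleC_add_left scaleC_scaleC scaleC_one)

lemma vector_space_complex_mult: "vector_space ((*) :: complex \<Rightarrow> complex \<Rightarrow> complex)"
  by unfold_locales (simp_all add: algebra_simps)

lemma scaleC_decompose: "a *\<^sub>C x = Re a *\<^sub>R x + Im a *\<^sub>R (\<i> *\<^sub>C x)"
proof -
  have "a *\<^sub>C x = (complex_of_real (Re a) + complex_of_real (Im a) * \<i>) *\<^sub>C x"
    using complex_eq[of a] by (simp add: mult.commute)
  then show ?thesis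
    by (simp only: scaleC_add_left scaleR_scaleC scaleC_scaleC)
qed

lemma scaleR_scaleC_commute: "c *\<^sub>R (a *\<^sub>C x) = a *\<^sub>C (c *\<^sub>R x)"
  by (simp add: scaleR_scaleC scaleC_scaleC mult.commute)

lemma scaleC_ii_ii: "\<i> *\<^sub>C \<i> *\<^sub>C x = - x"
  using scaleR_scaleC[of "- 1" x] by (simp add: scaleC_scaleC)

lemma cinner_scaleC_right: "cinner x (a *\<^sub>C y) = cnj a * cinner x y"
  by (metis cinner_commute cinner_scaleC_left complex_cnj_mult)

lemma norm_scaleC_ii: "norm (\<i> *\<^sub>C x) = norm x"
  by (simp add: norm_eq_sqrt_inner inner_eq_Re_cinner cinner_scaleC_left cinner_scaleC_right)

text \<open>Expressing \<open>cinner\<close> by real inner products transfers bounded linearity to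
  it.\<close>

lemma cinner_eq_inner: "cinner x y = complex_of_real (inner x y) + \<i> * complex_of_real (inner x (\<i> *\<^sub>C y))"
  by (rule complex_eqI) (simp_all add: inner_eq_Re_cinner cinner_scaleC_right)

lemma bounded_linear_scaleC_ii: "bounded_linear (scaleC \<i> :: 'a::complex_inner \<Rightarrow> 'a)"
  by (rule bounded_linear_intro[where K = 1])
    (simp_all add: scaleC_add_right scaleR_scaleC_commute norm_scaleC_ii)

text \<open>A real-linear map is complex-linear as soon as it commutes with \<i>, since every scalar
  is a real combination of 1 and \<i>.\<close>

lemma bounded_ops_complex_iff:
  "T \<in> bounded_ops (scaleC :: complex \<Rightarrow> 'a::complex_inner \<Rightarrow> 'a) \<longleftrightarrow> (\<forall>x. T (\<i> *\<^sub>C x) = \<i> *\<^sub>C T x)"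
proof
  assume *: "\<forall>x. T (\<i> *\<^sub>C x) = \<i> *\<^sub>C T x"
  have "T (c *\<^sub>C x) = c *\<^sub>C T x" for c x
    by (simp add: scaleC_decompose[of c] blinfun.add_right blinfun.scaleR_right *)
  then show "T \<in> bounded_ops scaleC"
    by (simp add: bounded_ops_def Vector_Spaces.linear_iff vector_space_scaleC blinfun.add_right)
qed (simp add: bounded_ops_def Vector_Spaces.linear_iff)

lemma compact_ops_complex_eq:
  "compact_ops (scaleC :: complex \<Rightarrow> 'a::complex_inner \<Rightarrow> 'a) = compact_ops scaleR \<inter> bounded_ops scaleC"
  by (auto simp: compact_ops_def bounded_ops_real)

lemma subspace_bounded_ops_complex:
  "subspace (bounded_ops (scaleC :: complex \<Rightarrow> 'a::complex_inner \<Rightarrow> 'a))"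
  by (auto simp: subspace_def bounded_ops_complex_iff blinfun.add_left blinfun.scaleR_left
      scaleC_add_right scaleR_scaleC_commute linear_0[OF bounded_linear.linear[OF bounded_linear_scaleC_ii]])

lemma closed_bounded_ops_complex:
  "closed (bounded_ops (scaleC :: complex \<Rightarrow> 'a::complex_inner \<Rightarrow> 'a))"
proof -
  have "bounded_ops (scaleC :: complex \<Rightarrow> 'a \<Rightarrow> 'a) = (\<Inter>x. {T. blinfun_apply T (\<i> *\<^sub>C x) = \<i> *\<^sub>C T x})"
    by (auto simp: bounded_ops_complex_iff)
  moreover have "closed {T :: 'a \<Rightarrow>\<^sub>L 'a. T (\<i> *\<^sub>C x) = \<i> *\<^sub>C T x}" for x
    by (intro closed_Collect_eq continuous_intros
        bounded_linear.continuous_on[OF bounded_linear_scaleC_ii])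
  ultimately show ?thesis
    by (metis (no_types, lifting) closed_INT)
qed

text \<open>The real and imaginary parts of a complex functional are real functionals, and each real
  inner product is the real part of a complex one.\<close>

lemma weakly_null_unit_seqs_complex_eq:
  "weakly_null_unit_seqs (scaleC :: complex \<Rightarrow> 'a::{complex_inner, complete_space} \<Rightarrow> 'a)
     = weakly_null_unit_seqs scaleR"
proof -
  have "weakly_tendsto scaleC s 0 \<longleftrightarrow> (\<forall>a. (\<lambda>n. inner a (s n)) \<longlonglongrightarrow> 0)" for s :: "nat \<Rightarrow> 'a"
  proof (intro iffI allI)
    fix a :: 'a
    assume w: "weakly_tendsto scaleC s 0"
    have "bounded_linear (\<lambda>x. complex_of_real (inner x a) + \<i> * complex_of_real (inner x (\<i> *\<^sub>C a)))"
      by (intro bounded_linear_add bounded_linear_const_mult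
          bounded_linear_compose[OF bounded_linear_of_real] bounded_linear_inner_left)
    then have bl: "bounded_linear (\<lambda>x. cinner x a)"
      by (simp add: cinner_eq_inner[abs_def])
    then have f: "blinfun_apply (Blinfun (\<lambda>x. cinner x a)) = (\<lambda>x. cinner x a)"
      by (rule bounded_linear_Blinfun_apply)
    have "Vector_Spaces.linear scaleC (*) (\<lambda>x. cinner x a)"
      by (simp add: Vector_Spaces.linear_iff vector_space_scaleC vector_space_complex_mult
          cinner_add_left cinner_scaleC_left)
    then have "(\<lambda>n. cinner (s n) a) \<longlonglongrightarrow> cinner 0 a"
      using w[unfolded weakly_tendsto_def, rule_format, of "Blinfun (\<lambda>x. cinner x a)"] by (simp add: f)
    then have "(\<lambda>n. Re (cinner (s n) a)) \<longlonglongrightarrow> Re (cinner 0 a)"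
      by (rule tendsto_Re)
    then show "(\<lambda>n. inner a (s n)) \<longlonglongrightarrow> 0"
      by (simp add: inner_eq_Re_cinner[symmetric] inner_commute)
  next
    assume w: "\<forall>a. (\<lambda>n. inner a (s n)) \<longlonglongrightarrow> 0"
    show "weakly_tendsto scaleC s 0"
      unfolding weakly_tendsto_def
    proof (intro allI impI)
      fix f :: "'a \<Rightarrow>\<^sub>L complex"
      obtain a where a: "\<And>x. Re (f x) = inner a x"
        using Riesz_representation[OF bounded_linear_compose[OF bounded_linear_Re blinfun.bounded_linear_right, of f]]
        by blast
      obtain b where b: "\<And>x. Im (f x) = inner b x"
        using Riesz_representation[OF bounded_linear_compose[OF bounded_linear_Im blinfun.bounded_linear_right, of f]]
        by blast
      show "(\<lambda>n. f (s n)) \<longlonglongrightarrow> f 0"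
        unfolding tendsto_complex_iff using w by (simp add: a b)
    qed
  qed
  then show ?thesis
    by (simp add: set_eq_iff weakly_null_unit_seqs_real_iff)
      (simp add: weakly_null_unit_seqs_def)
qed

lemma Delta_complex_eq:
  "Delta (scaleC :: complex \<Rightarrow> 'a::{complex_inner, complete_space} \<Rightarrow> 'a) T = Delta scaleR T"
  by (simp add: Delta_def weakly_null_unit_seqs_complex_eq)

text \<open>
  Averaging a real-linear approximant over conjugation with \<open>\<i>\<close> makes it complex-linear.
\<close>

lemma compact_approximant_complex:
  fixes T :: "'a::{complex_inner, complete_space} \<Rightarrow>\<^sub>L 'a"
  assumes T: "T \<in> bounded_ops scaleC"
    and "weakly_null_bound T r" "0 \<le> r" "norm T - 1 \<le> r"
  obtains K where "K \<in> compact_ops scaleC" "norm K \<le> 1" "norm (T - K) \<le> r"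
proof -
  obtain K where K: "K \<in> compact_ops scaleR" "norm K \<le> 1" "norm (T - K) \<le> r"
    using compact_approximant_real[OF assms(2-4)] .
  define J :: "'a \<Rightarrow>\<^sub>L 'a" where "J = Blinfun (scaleC \<i>)"
  have J: "J x = \<i> *\<^sub>C x" for x
    by (simp add: J_def bounded_linear_Blinfun_apply[OF bounded_linear_scaleC_ii])
  have JJ: "J (J x) = - x" for x
    by (simp add: J scaleC_ii_ii)
  have norm_J: "norm (J x) = norm x" for x
    by (simp add: J norm_scaleC_ii)
  \<comment> \<open>The inverse of \<open>J\<close> is \<open>- J\<close>, so this is the mean of
    \<open>S\<close> and its conjugate by \<open>J\<close>. It fixes complex-linear operators and
    does not increase norms, so \<open>avg K\<close> is as good an approximant to \<open>T\<close>
    as \<open>K\<close>.\<close>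
  define avg where "avg S = (1/2) *\<^sub>R (S - (J o\<^sub>L S o\<^sub>L J))" for S
  have norm_avg: "norm (avg S) \<le> norm S" for S
  proof (rule norm_blinfun_bound)
    fix x
    have "norm (S x - J (S (J x))) \<le> 2 * (norm S * norm x)"
      using norm_triangle_ineq4[of "S x" "J (S (J x))"] norm_blinfun[of S x] norm_blinfun[of S "J x"]
      unfolding norm_J by linarith
    then show "norm (avg S x) \<le> norm S * norm x"
      by (simp add: avg_def blinfun.scaleR_left blinfun.diff_left norm_J)
  qed simp
  have "avg T = T"
  proof (rule blinfun_eqI)
    fix x
    have "J (T (J x)) = - T x"
      using T by (simp add: J bounded_ops_complex_iff scaleC_ii_ii)
    then show "avg T x = T x"
      by (simp add: avg_def blinfun.scaleR_left blinfun.diff_left scaleR_2[symmetric])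
  qed
  moreover have "avg (T - K) = avg T - avg K"
    by (rule blinfun_eqI)
      (simp add: avg_def blinfun.scaleR_left blinfun.diff_left blinfun.diff_right scaleR_diff_right)
  ultimately have "norm (T - avg K) \<le> r"
    using norm_avg[of "T - K"] K(3) by simp
  moreover have "norm (avg K) \<le> 1"
    using norm_avg[of K] K(2) by simp
  moreover have "avg K \<in> compact_ops scaleC"
    unfolding compact_ops_complex_eq
  proof
    obtain C where C: "compact C" "\<And>x. norm x \<le> 1 \<Longrightarrow> K x \<in> C"
      using compact_ops_realE[OF K(1)] by blast
    have "compact (blinfun_apply J ` C)"
      by (intro compact_continuous_image continuous_intros C(1))
    then have "(J o\<^sub>L K o\<^sub>L J) \<in> compact_ops scaleR"
      by (rule compact_ops_realI) (simp add: C(2) norm_J)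
    then show "avg K \<in> compact_ops scaleR"
      unfolding avg_def using subspace_compact_ops_real K(1)
      by (intro subspace_scale subspace_diff)
    have "avg K (J x) = J (avg K x)" for x
      by (simp add: avg_def blinfun.scaleR_left blinfun.scaleR_right blinfun.diff_left
          blinfun.diff_right blinfun.minus_right JJ)
    then show "avg K \<in> bounded_ops scaleC"
      by (simp add: bounded_ops_complex_iff J)
  qed
  ultimately show ?thesis
    using that by blast
qed

section \<open>Ball proximinality and the theorem for both scalar fields\<close>

lemma ball_proximinal_inI:
  assumes "subspace Y" "closed Y" "Y \<subseteq> X"
    and "\<And>x. x \<in> X \<Longrightarrow> \<exists>k \<in> Y \<inter> cball 0 1. norm (x - k) = infdist x (Y \<inter> cball 0 1)"
  shows "ball_proximinal_in Y X"
  using assms subspace_0[OF assms(1)]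
  unfolding ball_proximinal_in_def proximinal_in_def by auto

theorem theorem2p1:
  "(infinite_dimensional (scaleR :: real \<Rightarrow> 'a::{real_inner, complete_space} \<Rightarrow> 'a) \<longrightarrow>
      (\<forall>T \<in> bounded_ops (scaleR :: real \<Rightarrow> 'a \<Rightarrow> 'a).
         ereal (infdist T (compact_ops scaleR \<inter> cball 0 1))
           = max (ereal (norm T - 1)) (Delta scaleR T) \<and>
         max (ereal (norm T - 1)) (Delta scaleR T)
           = ereal (max (norm T - 1) (infdist T (compact_ops scaleR)))) \<and>
      ball_proximinal_in (compact_ops (scaleR :: real \<Rightarrow> 'a \<Rightarrow> 'a)) (bounded_ops scaleR)) \<and>
   (infinite_dimensional (scaleC :: complex \<Rightarrow> 'b::{complex_inner, complete_space} \<Rightarrow> 'b) \<longrightarrow>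
      (\<forall>T \<in> bounded_ops (scaleC :: complex \<Rightarrow> 'b \<Rightarrow> 'b).
         ereal (infdist T (compact_ops scaleC \<inter> cball 0 1))
           = max (ereal (norm T - 1)) (Delta scaleC T) \<and>
         max (ereal (norm T - 1)) (Delta scaleC T)
           = ereal (max (norm T - 1) (infdist T (compact_ops scaleC)))) \<and>
      ball_proximinal_in (compact_ops (scaleC :: complex \<Rightarrow> 'b \<Rightarrow> 'b)) (bounded_ops scaleC))"
proof (rule conjI; rule impI)
  assume "infinite_dimensional (scaleR :: real \<Rightarrow> 'a \<Rightarrow> 'a)"
  then have nonempty: "weakly_null_unit_seqs (scaleR :: real \<Rightarrow> 'a \<Rightarrow> 'a) \<noteq> {}"
    by (intro weakly_null_unit_seqs_nonempty[of scaleR]) (auto intro: real_vector.vector_space_axioms)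
  have zero: "0 \<in> compact_ops (scaleR :: real \<Rightarrow> 'a \<Rightarrow> 'a)"
    by (rule subspace_0[OF subspace_compact_ops_real])
  have approximant: "\<exists>K\<in>compact_ops scaleR. norm K \<le> 1 \<and> norm (T - K) \<le> r"
    if "weakly_null_bound T r" "0 \<le> r" "norm T - 1 \<le> r" for T :: "'a \<Rightarrow>\<^sub>L 'a" and r
    using compact_approximant_real[OF that] by blast
  note formula = compact_distance_formula[OF order_refl zero nonempty approximant]
  have "ball_proximinal_in (compact_ops (scaleR :: real \<Rightarrow> 'a \<Rightarrow> 'a)) (bounded_ops scaleR)"
    by (intro ball_proximinal_inI subspace_compact_ops_real closed_compact_ops_real formula(3))
      (simp_all add: bounded_ops_real)
  then show "(\<forall>T \<in> bounded_ops (scaleR :: real \<Rightarrow> 'a \<Rightarrow> 'a).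
         ereal (infdist T (compact_ops scaleR \<inter> cball 0 1))
           = max (ereal (norm T - 1)) (Delta scaleR T) \<and>
         max (ereal (norm T - 1)) (Delta scaleR T)
           = ereal (max (norm T - 1) (infdist T (compact_ops scaleR)))) \<and>
      ball_proximinal_in (compact_ops (scaleR :: real \<Rightarrow> 'a \<Rightarrow> 'a)) (bounded_ops scaleR)"
    using formula(1,2) by blast
next
  assume "infinite_dimensional (scaleC :: complex \<Rightarrow> 'b \<Rightarrow> 'b)"
  then have nonempty: "weakly_null_unit_seqs (scaleR :: real \<Rightarrow> 'b \<Rightarrow> 'b) \<noteq> {}"
    by (rule weakly_null_unit_seqs_nonempty[OF vector_space_scaleC]) (metis scaleR_scaleC)
  have subspace: "subspace (compact_ops (scaleC :: complex \<Rightarrow> 'b \<Rightarrow> 'b))"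
    unfolding compact_ops_complex_eq
    by (intro subspace_inter subspace_compact_ops_real subspace_bounded_ops_complex)
  have sub: "compact_ops (scaleC :: complex \<Rightarrow> 'b \<Rightarrow> 'b) \<subseteq> compact_ops scaleR"
    by (simp add: compact_ops_complex_eq)
  have approximant: "\<exists>K\<in>compact_ops scaleC. norm K \<le> 1 \<and> norm (T - K) \<le> r"
    if "T \<in> bounded_ops scaleC" "weakly_null_bound T r" "0 \<le> r" "norm T - 1 \<le> r"
    for T :: "'b \<Rightarrow>\<^sub>L 'b" and r
    using compact_approximant_complex[OF that] by blast
  \<comment> \<open>Membership of \<open>T\<close> in \<open>bounded_ops scaleC\<close> remains a
    premise of \<open>formula\<close>, which speaks of \<open>Delta scaleR\<close>;
    \<open>Delta_complex_eq\<close> later rewrites the goal to match.\<close>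
  note formula = compact_distance_formula[OF sub subspace_0[OF subspace] nonempty approximant]
  have "ball_proximinal_in (compact_ops (scaleC :: complex \<Rightarrow> 'b \<Rightarrow> 'b)) (bounded_ops scaleC)"
  proof (intro ball_proximinal_inI subspace formula(3))
    show "closed (compact_ops (scaleC :: complex \<Rightarrow> 'b \<Rightarrow> 'b))"
      unfolding compact_ops_complex_eq
      by (intro closed_Int closed_compact_ops_real closed_bounded_ops_complex)
  qed (simp_all add: compact_ops_complex_eq)
  then show "(\<forall>T \<in> bounded_ops (scaleC :: complex \<Rightarrow> 'b \<Rightarrow> 'b).
         ereal (infdist T (compact_ops scaleC \<inter> cball 0 1))
           = max (ereal (norm T - 1)) (Delta scaleC T) \<and>
         max (ereal (norm T - 1)) (Delta scaleC T)
           = ereal (max (norm T - 1) (infdist T (compact_ops scaleC)))) \<and>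
      ball_proximinal_in (compact_ops (scaleC :: complex \<Rightarrow> 'b \<Rightarrow> 'b)) (bounded_ops scaleC)"
    unfolding Delta_complex_eq using formula(1,2) by blast
qed

end
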